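(* Let $K$ be an algebraically closed field and let $X$ be an irreducible affine variety given by a prime ideal $I_X\subseteq K[x_1,\dots,x_n]$, with an action of the additive group $\mathbb G_a$ given by $t\cdot v=\bigl(g_1(v,t),\dots,g_n(v,t)\bigr)$ for $v\in X$ and $t\in\mathbb G_a$, where $g_i\in K[x_1,\dots,x_n,z]$. Assume the $g_i$ are chosen in such a way that no coefficient occurring in a $g_i$ (as a polynomial in $z$) lies in $I_X$, let $d_j$ be the degree of $g_j$ as a polynomial in $z$, and assume that at least one $d_i$ is not divisible by $\operatorname{char}(K)$ (if $\operatorname{char}(K)=0$ this means that the action is nontrivial). Choose $i$ such that $d_i$ is not divisible by $\operatorname{char}(K)$ and write \[ g_i=\sum_{j=0}^{d_i}g_{i,j}\cdot z^{d_i-j},\qquad g_{i,j}\in K[x_1,\dots,x_n]. \] For $j=1,\dots,n$ let $h_j\in K(x_1,\dots,x_n)$ be the result of substituting $z=\dfrac{-g_{i,1}}{d_i\cdot g_{i,0}}$ in $g_j$. Set $a:=g_{i,0}+I_X$ and $b_j:=g_{i,0}^{d_j}h_j+I_X$. Then $a$ is nonzero, $a,b_1,\dots,b_n\in K[X]^{\mathbb G_a}$, and \[ K[X]^{\mathbb G_a}_a=K[a^{-1},a,b_1,\dots,b_n]. \] Moreover, there is a homomorphism of $K$-algebras $\phi\colon K[X]_a\to K[X]_a^{\mathbb G_a}$ given by \[ \phi(a^{-1})=a^{-1}\quad\text{and}\quad\phi(x_j+I_X)=a^{-d_j}b_j\quad(j=1,\dots,n), \] and $\phi$ is an invariantization map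 which is a homomorphism of $K[X]_a^{\mathbb G_a}$-algebras (in particular, it restricts to the identity on $K[X]_a^{\mathbb G_a}$).
   Context: $\mathbb G_a=(K,+)$ acts on $K[X]$ by $t\cdot f=f\circ(-t)$, i.e. $((-t)\cdot f)(v)=f(t\cdot v)$. $K[X]_a=K[X][a^{-1}]$ and $K[X]^{\mathbb G_a}_a=(K[X]^{\mathbb G_a})[a^{-1}]$. "Invariantization map" here means a map from $K[X]_a$ to $K[X]_a^{\mathbb G_a}$ that is linear over $K[X]_a^{\mathbb G_a}$ and fixes invariants. Integers divisible by $\operatorname{char}(K)=0$ means equal to $0$. If some $g_j=0$ put $d_j:=0$. *)

theory Defs
  imports
    "HOL-Library.Poly_Mapping"
    "HOL-Computational_Algebra.Computational_Algebra"
    "HOL-Algebra.Algebra"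
    "HOL-Algebra.Algebraic_Closure_Type"
begin

section \<open>Polynomials in finitely many indeterminates\<close>

text \<open>
  The indeterminates are indexed by the elements of a finite type; the linear order on it only serves
  to obtain the instance of class \<open>idom\<close>, hence the field of fractions.
\<close>

type_synonym ('n, 'k) mpoly = "('n \<Rightarrow>\<^sub>0 nat) \<Rightarrow>\<^sub>0 'k"

definition mconst :: "'k::zero \<Rightarrow> ('n, 'k) mpoly" where
  "mconst c = Poly_Mapping.single 0 c"

definition mvar :: "'n \<Rightarrow> ('n, 'k::zero_neq_one) mpoly" where
  "mvar j = Poly_Mapping.single (Poly_Mapping.single j 1) 1"

definition meval :: "('n::finite, 'k::comm_semiring_1) mpoly \<Rightarrow> ('n \<Rightarrow> 'k) \<Rightarrow> 'k" where
  "meval F v =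
    (\<Sum>m\<in>Poly_Mapping.keys F. Poly_Mapping.lookup F m * (\<Prod>j\<in>UNIV. v j ^ Poly_Mapping.lookup m j))"

abbreviation mpoly_ring :: "('n, 'k::comm_ring_1) mpoly ring" where
  "mpoly_ring \<equiv> ring_of_type_algebra"

definition zero_locus :: "('n::finite, 'k::comm_ring_1) mpoly set \<Rightarrow> ('n \<Rightarrow> 'k) set" where
  "zero_locus I = {v. \<forall>F\<in>I. meval F v = 0}"


section \<open>Coordinate ring\<close>

abbreviation coord_ring :: "('n, 'k::comm_ring_1) mpoly set \<Rightarrow> ('n, 'k) mpoly set ring" where
  "coord_ring I \<equiv> mpoly_ring Quot I"

abbreviation residue_class ::
  "('n, 'k::comm_ring_1) mpoly set \<Rightarrow> ('n, 'k) mpoly \<Rightarrow> ('n, 'k) mpoly set" where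
  "residue_class I F \<equiv> I +>\<^bsub>mpoly_ring\<^esub> F"

text \<open>
  The value of a residue class \<open>F + I\<close> at a point of the zero locus of \<open>I\<close>
  is the common value of all its representatives.
\<close>

definition coord_eval :: "('n::finite, 'k::comm_ring_1) mpoly set \<Rightarrow> ('n \<Rightarrow> 'k) \<Rightarrow> 'k" where
  "coord_eval f v = the_elem ((\<lambda>F. meval F v) ` f)"


section \<open>Actions of the additive group\<close>

text \<open>
  The polynomials \<open>g j\<close> lie in \<open>K[x][z]\<close>, and \<open>Ga_move g t v\<close> is the point
  \<open>(g\<^sub>1(v,t), \<dots>, g\<^sub>n(v,t))\<close>.
\<close>

definition Ga_move ::
  "('n \<Rightarrow> ('n::finite, 'k::comm_ring_1) mpoly poly) \<Rightarrow> 'k \<Rightarrow> ('n \<Rightarrow> 'k) \<Rightarrow> ('n \<Rightarrow> 'k)" where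
  "Ga_move g t v = (\<lambda>j. poly (map_poly (\<lambda>c. meval c v) (g j)) t)"

definition Ga_action_on ::
  "('n \<Rightarrow> 'k) set \<Rightarrow> ('n \<Rightarrow> ('n::finite, 'k::comm_ring_1) mpoly poly) \<Rightarrow> bool" where
  "Ga_action_on V g \<longleftrightarrow>
    group_action (add_monoid (ring_of_type_algebra :: 'k ring)) V (\<lambda>t. \<lambda>v\<in>V. Ga_move g t v)"

text \<open>
  The induced action \<open>t \<cdot> f = f \<circ> (-t)\<close> on the coordinate ring of a variety \<open>V\<close>;
  the name \<open>V\<close> is used because \<open>X\<close> is reserved syntax of \<open>HOL-Algebra.Polynomials\<close>.
\<close>

definition Ga_act ::
  "('n \<Rightarrow> 'k) set \<Rightarrow> ('n, 'k) mpoly set \<Rightarrow> ('n \<Rightarrow> ('n::finite, 'k::comm_ring_1) mpoly poly) \<Rightarrow>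
    'k \<Rightarrow> ('n, 'k) mpoly set \<Rightarrow> ('n, 'k) mpoly set" where
  "Ga_act V I g t f =
    (THE h. h \<in> carrier (coord_ring I) \<and>
      (\<forall>v\<in>V. coord_eval h v = coord_eval f (Ga_move g (- t) v)))"

definition Ga_invariants ::
  "('n \<Rightarrow> 'k) set \<Rightarrow> ('n, 'k) mpoly set \<Rightarrow> ('n \<Rightarrow> ('n::finite, 'k::comm_ring_1) mpoly poly) \<Rightarrow>
    ('n, 'k) mpoly set set" where
  "Ga_invariants V I g = {f \<in> carrier (coord_ring I). \<forall>t. Ga_act V I g t f = f}"


section \<open>Localization of a commutative ring at the powers of an element\<close>

text \<open>
  \<open>loc_frac R a r m\<close> is the fraction \<open>r / a\<^sup>m\<close>, as a class of pairs.
\<close>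

definition loc_frac :: "('r, 'm) ring_scheme \<Rightarrow> 'r \<Rightarrow> 'r \<Rightarrow> nat \<Rightarrow> ('r \<times> nat) set" where
  "loc_frac R a r m =
    {(s, n). s \<in> carrier R \<and>
      (\<exists>k::nat. a [^]\<^bsub>R\<^esub> k \<otimes>\<^bsub>R\<^esub> (r \<otimes>\<^bsub>R\<^esub> a [^]\<^bsub>R\<^esub> n) = a [^]\<^bsub>R\<^esub> k \<otimes>\<^bsub>R\<^esub> (s \<otimes>\<^bsub>R\<^esub> a [^]\<^bsub>R\<^esub> m))}"

definition localization :: "('r, 'm) ring_scheme \<Rightarrow> 'r \<Rightarrow> ('r \<times> nat) set ring" where
  "localization R a =
    \<lparr> carrier = {loc_frac R a r m |r m. r \<in> carrier R},
      monoid.mult = (\<lambda>u w. \<Union>(r, m)\<in>u. \<Union>(s, n)\<in>w. loc_frac R a (r \<otimes>\<^bsub>R\<^esub> s) (m + n)),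
      one = loc_frac R a \<one>\<^bsub>R\<^esub> 0,
      ring.zero = loc_frac R a \<zero>\<^bsub>R\<^esub> 0,
      add = (\<lambda>u w. \<Union>(r, m)\<in>u. \<Union>(s, n)\<in>w.
        loc_frac R a (r \<otimes>\<^bsub>R\<^esub> a [^]\<^bsub>R\<^esub> n \<oplus>\<^bsub>R\<^esub> s \<otimes>\<^bsub>R\<^esub> a [^]\<^bsub>R\<^esub> m) (m + n)) \<rparr>"


section \<open>Algebras and invariantization maps\<close>

text \<open>
  Algebras over a subring \<open>A\<close> are treated in the style of \<^theory>\<open>HOL-Algebra.Embedded_Algebras\<close>:
  \<open>A\<close> is contained in the algebra, and its elements act by multiplication.
\<close>

definition subalgebra_generated :: "('r, 'm) ring_scheme \<Rightarrow> 'r set \<Rightarrow> 'r set \<Rightarrow> 'r set" where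
  "subalgebra_generated R A S = generate_ring R (A \<union> S)"

definition algebra_hom ::
  "'r set \<Rightarrow> ('r, 'm) ring_scheme \<Rightarrow> ('r, 'l) ring_scheme \<Rightarrow> ('r \<Rightarrow> 'r) \<Rightarrow> bool" where
  "algebra_hom A R S \<phi> \<longleftrightarrow>
    \<phi> \<in> ring_hom R S \<and> (\<forall>c\<in>A. \<forall>u\<in>carrier R. \<phi> (c \<otimes>\<^bsub>R\<^esub> u) = c \<otimes>\<^bsub>S\<^esub> \<phi> u)"

definition invariantization_map :: "('r, 'm) ring_scheme \<Rightarrow> 'r set \<Rightarrow> ('r \<Rightarrow> 'r) \<Rightarrow> bool" where
  "invariantization_map R A \<phi> \<longleftrightarrow>
    \<phi> \<in> carrier R \<rightarrow> A \<and>
    (\<forall>u\<in>carrier R. \<forall>w\<in>carrier R. \<phi> (u \<oplus>\<^bsub>R\<^esub> w) = \<phi> u \<oplus>\<^bsub>R\<^esub> \<phi> w) \<and>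
    (\<forall>c\<in>A. \<forall>u\<in>carrier R. \<phi> (c \<otimes>\<^bsub>R\<^esub> u) = c \<otimes>\<^bsub>R\<^esub> \<phi> u) \<and>
    (\<forall>c\<in>A. \<phi> c = c)"


section \<open>The substitution\<close>

text \<open>
  The coefficients of \<open>g\<^sub>i\<close> are numbered from the top:
  \<open>g\<^sub>i = \<Sum>\<^sub>j g\<^sub>i\<^sub>,\<^sub>j z ^ (d\<^sub>i - j)\<close>.
\<close>

definition top_coeff :: "'c::zero poly \<Rightarrow> nat \<Rightarrow> 'c" where
  "top_coeff p j = coeff p (degree p - j)"

definition slice_subst ::
  "('n \<Rightarrow> ('n::{finite,linorder}, 'k::field) mpoly poly) \<Rightarrow> 'n \<Rightarrow> 'n \<Rightarrow> ('n, 'k) mpoly fract" where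
  "slice_subst g i j =
    poly (fract_poly (g j))
      (- to_fract (top_coeff (g i) 1) / (of_nat (degree (g i)) * to_fract (top_coeff (g i) 0)))"

end

theory Submission
  imports Defs
begin

text \<open>
  The leading coefficient \<open>a\<close> of \<open>g\<^sub>i\<close> is invariant and
  \<open>\<sigma> = - g\<^sub>i\<^sub>,\<^sub>1 / (d\<^sub>i a)\<close> satisfies \<open>\<sigma>(t \<cdot> v) = \<sigma>(v) - t\<close>: both facts drop out of the two
  top coefficients of \<open>g\<^sub>i(t \<cdot> v, s) = g\<^sub>i(v, s + t)\<close>, read as polynomials in \<open>s\<close>
  (\<open>A0_move\<close>, \<open>A1_move\<close>); invertibility of \<open>d\<^sub>i\<close> in \<open>K\<close> is what makes \<open>\<sigma>\<close> exist.
  On the open set \<open>D\<close> where \<open>a\<close> does not vanish, moving each point \<open>v\<close> by \<open>\<sigma>(v)\<close> is therefore a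
  map \<open>proj\<close> that is constant on orbits (\<open>proj_move\<close>): it sends an orbit to its unique point
  with \<open>\<sigma> = 0\<close>.  Its coordinates are the \<open>h\<^sub>j\<close>, that is \<open>b\<^sub>j / a ^ d\<^sub>j\<close> (\<open>meval_B\<close>).

  Composition with \<open>proj\<close> is the invariantization \<open>\<phi>\<close>.  It is a ring homomorphism because
  it is a pullback, it fixes invariants because \<open>proj v\<close> lies on the orbit of \<open>v\<close>, and every value
  is a polynomial in the \<open>b\<^sub>j\<close> and \<open>a\<^sup>-\<^sup>1\<close> (\<open>proj_pullback\<close>).  So an invariant
  \<open>f = \<phi>(f)\<close> lies in \<open>K[a\<^sup>-\<^sup>1, a, b\<^sub>1, \<dots>, b\<^sub>n]\<close>; this is how \<open>Kab_eq\<close> and \<open>KXGa_eq\<close>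
  identify the two algebras.

  All of this is computed with functions on points.  That elements of \<open>K[X]\<close> and of \<open>K[X]\<^sub>a\<close> are
  determined by their values on \<open>V\<close> and on \<open>D\<close> is Hilbert's Nullstellensatz for prime ideals
  (\<open>nullstellensatz_prime\<close>).  It is obtained by adjoining the variables one at a time and
  extending homomorphisms to \<open>K\<close> from \<open>A\<close> to \<open>A[x]\<close> (\<open>extend_hom_step\<close>), by the elementary
  argument with pseudo-division: if \<open>x\<close> is transcendental over \<open>A\<close>, almost any value will do for it,
  and if \<open>x\<close> is algebraic, a root of the specialised polynomial of least degree will do.
\<close>

section \<open>Evaluation of polynomials\<close>

lemma meval_eq_sum_superset:
  fixes F :: "('n::finite, 'k::comm_semiring_1) mpoly"
  assumes "finite S" "Poly_Mapping.keys F \<subseteq> S"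
  shows "meval F v =
    (\<Sum>m\<in>S. Poly_Mapping.lookup F m * (\<Prod>j\<in>UNIV. v j ^ Poly_Mapping.lookup m j))"
  unfolding meval_def using assms
  by (intro sum.mono_neutral_left) (auto simp: in_keys_iff)

lemma meval_0 [simp]: "meval 0 v = 0"
  by (simp add: meval_def)

lemma meval_single [simp]:
  "meval (Poly_Mapping.single m c) v = c * (\<Prod>j\<in>UNIV. v j ^ Poly_Mapping.lookup m j)"
  by (subst meval_eq_sum_superset[of "{m}"]) auto

lemma meval_add [simp]: "meval (F + G) v = meval F v + meval G v"
proof -
  let ?S = "Poly_Mapping.keys F \<union> Poly_Mapping.keys G"
  have "meval (F + G) v = (\<Sum>m\<in>?S. Poly_Mapping.lookup (F + G) m *
      (\<Prod>j\<in>UNIV. v j ^ Poly_Mapping.lookup m j))"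
    by (rule meval_eq_sum_superset) (auto simp: Poly_Mapping.keys_add)
  also have "\<dots> = meval F v + meval G v"
    by (simp add: lookup_add distrib_right sum.distrib
        meval_eq_sum_superset[of ?S F] meval_eq_sum_superset[of ?S G])
  finally show ?thesis .
qed

lemma poly_mapping_induct_add [case_names zero single add]:
  fixes F :: "'a \<Rightarrow>\<^sub>0 'b::comm_monoid_add"
  assumes "P 0" "\<And>m c. P (Poly_Mapping.single m c)" "\<And>F G. P F \<Longrightarrow> P G \<Longrightarrow> P (F + G)"
  shows "P F"
proof (induction F rule: Poly_Mapping.update_induct)
  case const
  then show ?case by (rule assms(1))
next
  case (update f a b)
  have "Poly_Mapping.update a b f = f + Poly_Mapping.single a b"
    using update(1) by (intro poly_mapping_eqI)
      (auto simp: lookup_update lookup_add lookup_single in_keys_iff)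
  then show ?case using assms(2,3) update by auto
qed

lemma meval_mult [simp]: "meval (F * G) v = meval F v * meval G v"
proof (induction F rule: poly_mapping_induct_add)
  case (single m c)
  show ?case
  proof (induction G rule: poly_mapping_induct_add)
    case (single m' c')
    show ?case by (simp add: mult_single lookup_add power_add prod.distrib mult_ac)
  qed (simp_all add: distrib_left)
qed (simp_all add: distrib_right)

lemma meval_mconst [simp]: "meval (mconst c) v = c"
  by (simp add: mconst_def)

lemma meval_1 [simp]: "meval 1 v = 1"
  using meval_mconst[of 1 v] by (simp add: mconst_def)

lemma meval_mvar [simp]: "meval (mvar j) v = v j"
proof -
  have "(\<Prod>l\<in>UNIV. v l ^ Poly_Mapping.lookup (Poly_Mapping.single j 1) l) = (\<Prod>l\<in>UNIV. if l = j then v l else 1)"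
    by (intro prod.cong) (auto simp: lookup_single when_def)
  then show ?thesis by (simp add: mvar_def)
qed

lemma meval_uminus [simp]:
  fixes F :: "('n::finite, 'k::comm_ring_1) mpoly"
  shows "meval (- F) v = - meval F v"
  using meval_add[of F "- F" v] by (simp add: eq_neg_iff_add_eq_0 add.commute)

lemma meval_diff [simp]:
  fixes F :: "('n::finite, 'k::comm_ring_1) mpoly"
  shows "meval (F - G) v = meval F v - meval G v"
  using meval_add[of F "- G" v] by simp

lemma meval_power [simp]: "meval (F ^ n) v = meval F v ^ n"
  by (induction n) auto

lemma meval_sum [simp]: "meval (sum f S) v = (\<Sum>s\<in>S. meval (f s) v)"
  by (induction S rule: infinite_finite_induct) auto

text \<open>
  Generation by constants and variables, rather than a condition on the monomials, gives the
  induction rule by which statements about polynomials are proved below.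
\<close>

inductive_set mpolys_in :: "'n set \<Rightarrow> ('n, 'k::comm_ring_1) mpoly set" for S :: "'n set" where
  const: "mconst c \<in> mpolys_in S"
| var: "j \<in> S \<Longrightarrow> mvar j \<in> mpolys_in S"
| add: "F \<in> mpolys_in S \<Longrightarrow> G \<in> mpolys_in S \<Longrightarrow> F + G \<in> mpolys_in S"
| mult: "F \<in> mpolys_in S \<Longrightarrow> G \<in> mpolys_in S \<Longrightarrow> F * G \<in> mpolys_in S"

lemma mconst_simps:
  "mconst 0 = 0" "mconst 1 = 1" "mconst (a + b) = mconst a + mconst b"
  "mconst (a * b) = mconst a * mconst b"
  by (simp_all add: mconst_def single_add mult_single)

text \<open>
  Every polynomial is a sum of terms, and a term is a product of a constant and variables; hence
  rule induction over \<open>mpolys_in UNIV\<close> is available for arbitrary polynomials.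
\<close>

lemma mpolys_in_UNIV: "F \<in> mpolys_in UNIV"
proof (induction F rule: poly_mapping_induct_add)
  case zero
  show ?case using mpolys_in.const[of 0] by (simp add: mconst_simps)
next
  case (add F G)
  then show ?case by (rule mpolys_in.add)
next
  case (single m c)
  have "Poly_Mapping.single (Poly_Mapping.single j b) 1 \<in> (mpolys_in UNIV :: ('a, 'b) mpoly set)" for j b
  proof (induction b)
    case 0
    show ?case using mpolys_in.const[of 1] by (simp add: mconst_def)
  next
    case (Suc b)
    have "(Poly_Mapping.single (Poly_Mapping.single j (Suc b)) 1 :: ('a, 'b) mpoly)
        = mvar j * Poly_Mapping.single (Poly_Mapping.single j b) 1"
      by (simp add: mvar_def mult_single flip: single_add)
    then show ?case using Suc by (simp only:) (intro mpolys_in.mult mpolys_in.var UNIV_I)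
  qed
  note pow = this
  have "Poly_Mapping.single m 1 \<in> (mpolys_in UNIV :: ('a, 'b) mpoly set)"
  proof (induction m rule: poly_mapping_induct_add)
    case zero
    show ?case using mpolys_in.const[of 1] by (simp add: mconst_def)
  next
    case (single j b)
    show ?case by (rule pow)
  next
    case (add m m')
    then have "Poly_Mapping.single m 1 * Poly_Mapping.single m' 1 \<in> (mpolys_in UNIV :: ('a, 'b) mpoly set)"
      by (rule mpolys_in.mult)
    then show ?case by (simp add: mult_single)
  qed
  then have "mconst c * Poly_Mapping.single m 1 \<in> mpolys_in UNIV"
    by (intro mpolys_in.mult mpolys_in.const)
  then show ?case by (simp add: mconst_def mult_single)
qed

lemma mpolys_in_uminus: "F \<in> mpolys_in S \<Longrightarrow> - F \<in> mpolys_in S"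
proof -
  assume "F \<in> mpolys_in S"
  then have "mconst (- 1) * F \<in> mpolys_in S" by (intro mpolys_in.intros)
  moreover have "mconst (- 1) = (- 1 :: ('a, 'b) mpoly)" 
    by (metis mconst_simps(1,2,3) add.right_inverse eq_neg_iff_add_eq_0 add.commute)
  ultimately show ?thesis by simp
qed

section \<open>Ring homomorphisms and univariate polynomials\<close>

definition is_ring_hom :: "('a::comm_ring_1 \<Rightarrow> 'b::comm_ring_1) \<Rightarrow> bool" where
  "is_ring_hom f \<longleftrightarrow> f 1 = 1 \<and> (\<forall>a b. f (a + b) = f a + f b) \<and> (\<forall>a b. f (a * b) = f a * f b)"

lemma is_ring_homD:
  assumes "is_ring_hom f"
  shows "f 1 = 1" "f (a + b) = f a + f b" "f (a * b) = f a * f b" "f 0 = 0" "f (- a) = - f a"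
    "f (a - b) = f a - f b" "f (a ^ n) = f a ^ n" "f (sum g S) = (\<Sum>s\<in>S. f (g s))"
proof -
  show 1: "f 1 = 1" "\<And>a b. f (a + b) = f a + f b" "\<And>a b. f (a * b) = f a * f b"
    using assms by (auto simp: is_ring_hom_def)
  show 0: "f 0 = 0" using 1(2)[of 0 0] by simp
  show m: "f (- a) = - f a" for a
    using 1(2)[of a "- a"] 0 by (simp add: eq_neg_iff_add_eq_0 add.commute)
  show "f (a - b) = f a - f b" using 1(2)[of a "- b"] m[of b] by simp
  show "f (a ^ n) = f a ^ n" by (induction n) (use 1 in auto)
  show "f (sum g S) = (\<Sum>s\<in>S. f (g s))"
    by (induction S rule: infinite_finite_induct) (use 1 0 in auto)
qed

lemma is_ring_hom_meval: "is_ring_hom (\<lambda>F. meval F v)"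
  by (simp add: is_ring_hom_def)

lemma poly_map_poly_hom:
  assumes "is_ring_hom f"
  shows "f (poly p x) = poly (map_poly f p) (f x)"
  by (induction p) (simp_all add: is_ring_homD[OF assms] map_poly_pCons)

lemma map_poly_hom:
  assumes "is_ring_hom f"
  shows "map_poly f (p + q) = map_poly f p + map_poly f q"
    "map_poly f (p * q) = map_poly f p * map_poly f q"
    "map_poly f (p - q) = map_poly f p - map_poly f q"
    "map_poly f (smult c p) = smult (f c) (map_poly f p)"
  by (rule poly_eqI; simp add: coeff_map_poly coeff_mult is_ring_homD[OF assms])+

text \<open>
  If \<open>K\<close> were finite, \<open>1 + \<Prod>a. (x - a)\<close> would be a polynomial of positive degree without a root.
\<close>

lemma infinite_alg_closed_field: "infinite (UNIV :: 'k::alg_closed_field set)"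
proof
  assume fin: "finite (UNIV :: 'k set)"
  define p where "p = (\<Prod>a\<in>(UNIV::'k set). [:- a, 1:]) + 1"
  have deg: "degree (\<Prod>a\<in>(UNIV::'k set). [:- a, 1:]) = card (UNIV :: 'k set)"
    by (simp add: degree_prod_eq_sum_degree)
  have "card (UNIV :: 'k set) > 0" using fin by (simp add: card_gt_0_iff)
  then have "degree p > 0" unfolding p_def using deg by (subst degree_add_eq_left) auto
  then obtain x where "poly p x = 0" using alg_closed_imp_poly_has_root by blast
  moreover have "poly p x = 1" using fin by (auto simp: p_def poly_prod)
  ultimately show False by simp
qed

lemma ex_not_root:
  fixes p :: "'k::alg_closed_field poly"
  assumes "p \<noteq> 0" shows "\<exists>x. poly p x \<noteq> 0"
  using poly_roots_finite[OF assms] infinite_alg_closed_field[where 'k='k]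
  by (metis (mono_tags, lifting) Collect_cong UNIV_def)

lemma poly_ext:
  fixes p q :: "'k::alg_closed_field poly"
  assumes "\<And>x. poly p x = poly q x" shows "p = q"
  using ex_not_root[of "p - q"] assms by auto

section \<open>Extension of homomorphisms to a simple extension\<close>

text \<open>
  The image of \<open>A\<close> in the domain \<open>'a / P\<close> plays the role of a coefficient ring to which an element
  \<open>x\<close> is adjoined.  Quotients are avoided: equality in \<open>'a / P\<close> is expressed by membership of
  differences in \<open>P\<close>.
\<close>

locale prime_over_subring =
  fixes P A :: "'a::idom set"
  assumes P_zero: "0 \<in> P" and P_add: "a \<in> P \<Longrightarrow> b \<in> P \<Longrightarrow> a + b \<in> P"
    and P_mult: "b \<in> P \<Longrightarrow> a * b \<in> P" and P_proper: "1 \<notin> P"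
    and P_prime: "a * b \<in> P \<Longrightarrow> a \<in> P \<or> b \<in> P"
    and A_zero: "0 \<in> A" and A_one: "1 \<in> A" and A_add: "a \<in> A \<Longrightarrow> b \<in> A \<Longrightarrow> a + b \<in> A"
    and A_uminus: "a \<in> A \<Longrightarrow> - a \<in> A" and A_mult: "a \<in> A \<Longrightarrow> b \<in> A \<Longrightarrow> a * b \<in> A"
begin

lemma P_uminus: "a \<in> P \<Longrightarrow> - a \<in> P"
  using P_mult[of a "- 1"] by simp

lemma P_diff: "a \<in> P \<Longrightarrow> b \<in> P \<Longrightarrow> a - b \<in> P"
  using P_add[of a "- b"] P_uminus by simp

lemma P_mult': "b \<in> P \<Longrightarrow> b * a \<in> P"
  using P_mult[of b a] by (simp add: mult.commute)

lemma P_sum: "(\<And>s. s \<in> S \<Longrightarrow> f s \<in> P) \<Longrightarrow> sum f S \<in> P"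
  by (induction S rule: infinite_finite_induct) (auto intro: P_zero P_add)

lemma P_power: "a ^ k \<in> P \<Longrightarrow> a \<in> P"
  by (induction k) (use P_proper P_prime in auto)

lemma A_sum: "(\<And>s. s \<in> S \<Longrightarrow> f s \<in> A) \<Longrightarrow> sum f S \<in> A"
  by (induction S rule: infinite_finite_induct) (auto intro: A_zero A_add)

lemma A_power: "a \<in> A \<Longrightarrow> a ^ k \<in> A"
  by (induction k) (auto intro: A_one A_mult)

definition AX :: "'a poly set" where "AX = {p. \<forall>n. coeff p n \<in> A}"

definition PX :: "'a poly set" where "PX = {p. \<forall>n. coeff p n \<in> P}"

lemma AX_coeff: "p \<in> AX \<Longrightarrow> coeff p n \<in> A"
  by (simp add: AX_def)

lemma AX_zero: "0 \<in> AX" by (simp add: AX_def A_zero)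
lemma AX_const: "c \<in> A \<Longrightarrow> [:c:] \<in> AX"
  by (auto simp: AX_def coeff_pCons A_zero split: nat.split)
lemma AX_add: "p \<in> AX \<Longrightarrow> q \<in> AX \<Longrightarrow> p + q \<in> AX" by (simp add: AX_def A_add)
lemma AX_uminus: "p \<in> AX \<Longrightarrow> - p \<in> AX" by (simp add: AX_def A_uminus)
lemma AX_diff: "p \<in> AX \<Longrightarrow> q \<in> AX \<Longrightarrow> p - q \<in> AX"
  using AX_add[of p "- q"] AX_uminus by simp
lemma AX_mult: "p \<in> AX \<Longrightarrow> q \<in> AX \<Longrightarrow> p * q \<in> AX"
  by (simp add: AX_def coeff_mult A_sum A_mult)
lemma AX_smult: "c \<in> A \<Longrightarrow> p \<in> AX \<Longrightarrow> smult c p \<in> AX" by (simp add: AX_def A_mult)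
lemma AX_monom: "c \<in> A \<Longrightarrow> monom c n \<in> AX" by (simp add: AX_def A_zero)

lemma PX_mult: "q \<in> PX \<Longrightarrow> p * q \<in> PX"
  by (simp add: PX_def coeff_mult P_sum P_mult)
lemma PX_add: "p \<in> PX \<Longrightarrow> q \<in> PX \<Longrightarrow> p + q \<in> PX" by (simp add: PX_def P_add)
lemma PX_poly: "p \<in> PX \<Longrightarrow> poly p x \<in> P"
  by (simp add: PX_def poly_altdef P_sum P_mult')

text \<open>
  The degree modulo \<open>P\<close> may be smaller than the degree.  Cutting off the coefficients in \<open>P\<close> above the
  last one outside \<open>P\<close> makes the two agree.
\<close>

lemma drop_leading_P:
  assumes "q \<in> AX" "q \<notin> PX"
  obtains q' where "q' \<in> AX" "lead_coeff q' \<notin> P" "q - q' \<in> PX" "degree q' \<le> degree q"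
proof -
  define N where "N = Max {n. coeff q n \<notin> P}"
  have sub: "{n. coeff q n \<notin> P} \<subseteq> {..degree q}"
    using P_zero coeff_eq_0 by (force simp: not_le[symmetric])
  then have fin: "finite {n. coeff q n \<notin> P}" by (rule finite_subset) auto
  have ne: "{n. coeff q n \<notin> P} \<noteq> {}" using assms(2) by (auto simp: PX_def)
  have N: "coeff q N \<notin> P" using Max_in[OF fin ne] by (simp add: N_def)
  have above: "coeff q n \<in> P" if "n > N" for n
    using Max_ge[OF fin, of n] that unfolding N_def by (metis (lifting) mem_Collect_eq not_le)
  define q' where "q' = poly_cutoff (Suc N) q"
  have "degree q' \<le> N" by (rule degree_le) (auto simp: q'_def coeff_poly_cutoff)
  moreover have "coeff q' N = coeff q N" by (simp add: q'_def coeff_poly_cutoff)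
  moreover have "coeff q' N \<noteq> 0" using calculation N P_zero by auto
  ultimately have deg: "degree q' = N" using le_degree by (metis le_antisym)
  show ?thesis
  proof
    show "q' \<in> AX" using assms(1) by (auto simp: AX_def q'_def coeff_poly_cutoff A_zero)
    show "lead_coeff q' \<notin> P" using deg N \<open>coeff q' N = coeff q N\<close> by simp
    show "q - q' \<in> PX" using above by (auto simp: PX_def q'_def coeff_poly_cutoff P_zero)
    show "degree q' \<le> degree q" using sub N deg by auto
  qed
qed

lemma pseudo_division:
  assumes p: "p \<in> AX" "degree p > 0" and h: "h \<in> AX"
  obtains k w r where "w \<in> AX" "r \<in> AX" "degree r < degree p"
    "smult (lead_coeff p ^ k) h = p * w + r"
proof -
  have "\<exists>k w r. w \<in> AX \<and> r \<in> AX \<and> degree r < degree p \<and> smult (lead_coeff p ^ k) h = p * w + r"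
    using h
  proof (induction "degree h" arbitrary: h rule: less_induct)
    case less
    show ?case
    proof (cases "degree h < degree p")
      case True
      then show ?thesis using less.prems by (intro exI[of _ 0] exI[of _ h]) (auto simp: AX_zero)
    next
      case False
      define e where "e = degree h - degree p"
      define m where "m = monom (lead_coeff h) e"
      define h' where "h' = smult (lead_coeff p) h - p * m"
      have m: "m \<in> AX" unfolding m_def using less.prems by (intro AX_monom AX_coeff)
      have h'A: "h' \<in> AX" unfolding h'_def using less.prems p(1) m
        by (intro AX_diff AX_smult AX_mult AX_coeff)
      have dm: "degree (p * m) \<le> degree h"
        using degree_mult_le[of p m] degree_monom_le[of "lead_coeff h" e] False
        unfolding m_def e_def by linarith
      have "degree h' \<le> degree h" unfolding h'_def
        by (rule degree_diff_le) (use dm in \<open>auto simp: degree_smult_le\<close>)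
      moreover have "coeff h' (degree h) = 0"
      proof -
        have "coeff (p * m) (degree h) = lead_coeff h * lead_coeff p"
          using False unfolding m_def e_def by (subst mult.commute) (simp add: coeff_monom_mult)
        then show ?thesis by (simp add: h'_def)
      qed
      ultimately have "degree h' < degree h"
        using False p(2) by (metis degree_0 eq_zero_or_degree_less not_gr0 not_le order.strict_trans2)
      from less.hyps[OF this h'A] obtain k w r where
        IH: "w \<in> AX" "r \<in> AX" "degree r < degree p" "smult (lead_coeff p ^ k) h' = p * w + r"
        by blast
      have "smult (lead_coeff p ^ Suc k) h =
          smult (lead_coeff p ^ k) h' + p * smult (lead_coeff p ^ k) m"
        by (simp add: h'_def smult_diff_right mult.commute)
      also have "\<dots> = p * (w + smult (lead_coeff p ^ k) m) + r"
        by (simp add: IH(4) algebra_simps)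
      finally show ?thesis
        using IH m p(1) by (intro exI[of _ "Suc k"] exI[of _ "w + smult (lead_coeff p ^ k) m"] exI[of _ r])
          (auto intro!: AX_add AX_smult A_power AX_coeff)
    qed
  qed
  then show ?thesis using that by blast
qed

text \<open>
  When no polynomial relation over \<open>A\<close> holds for \<open>x\<close> modulo \<open>P\<close>, the image of \<open>x\<close> may be any
  \<open>\<xi>\<close>, so it suffices to avoid the roots of one nonzero polynomial over an infinite field.
\<close>

lemma extend_hom_transcendental:
  fixes f :: "'a \<Rightarrow> 'k::alg_closed_field"
  assumes f: "is_ring_hom f" and fP: "\<And>a. a \<in> A \<Longrightarrow> a \<in> P \<Longrightarrow> f a = 0"
    and trans: "\<And>h. h \<in> AX \<Longrightarrow> poly h x \<in> P \<Longrightarrow> h \<in> PX"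
    and u: "f (coeff q n) \<noteq> 0"
  shows "\<exists>\<xi>. (\<forall>h\<in>AX. poly h x \<in> P \<longrightarrow> poly (map_poly f h) \<xi> = 0) \<and> poly (map_poly f q) \<xi> \<noteq> 0"
proof -
  note hom = is_ring_homD[OF f]
  have "coeff (map_poly f q) n \<noteq> 0" using u by (simp add: coeff_map_poly hom)
  then obtain \<xi> where "poly (map_poly f q) \<xi> \<noteq> 0" using ex_not_root by (metis coeff_0)
  moreover have "map_poly f h = 0" if "h \<in> AX" "poly h x \<in> P" for h
    using trans[OF that] that(1) fP by (intro poly_eqI) (auto simp: AX_def PX_def coeff_map_poly hom)
  ultimately show ?thesis by auto
qed

text \<open>
  If \<open>x\<close> is algebraic over \<open>A\<close> modulo \<open>P\<close>, a relation \<open>p\<close> of least degree acts as a minimal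
  polynomial: by pseudo-division it divides every other relation, up to a power of its leading
  coefficient and modulo \<open>P\<close>.  Since \<open>y = q(x)\<close> is nonzero, it is a unit up to a denominator, that is, there are
  \<open>s\<close> and a constant \<open>c\<close> outside \<open>P\<close> with \<open>s(x) y\<close> congruent to \<open>c\<close>; this is the Bezout identity for
  the coprime pair \<open>p\<close>, \<open>q\<close>.  A homomorphism that does not kill \<open>u = lead_coeff p * c\<close> extends
  by sending \<open>x\<close> to any root of the image of \<open>p\<close>, and the extension cannot kill \<open>y\<close> as it does not
  kill \<open>c\<close>.
\<close>

lemma extend_hom_step:
  assumes q: "q \<in> AX" "poly q x \<notin> P"
  obtains u where "u \<in> A" "u \<notin> P"
    "\<And>f :: 'a \<Rightarrow> 'k::alg_closed_field. is_ring_hom f \<Longrightarrow> (\<And>a. a \<in> A \<Longrightarrow> a \<in> P \<Longrightarrow> f a = 0) \<Longrightarrow> f u \<noteq> 0 \<Longrightarrow>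
      \<exists>\<xi>. (\<forall>h\<in>AX. poly h x \<in> P \<longrightarrow> poly (map_poly f h) \<xi> = 0) \<and> poly (map_poly f q) \<xi> \<noteq> 0"
proof (cases "\<forall>h\<in>AX. poly h x \<in> P \<longrightarrow> h \<in> PX")
  case True
  have "q \<notin> PX" using q(2) PX_poly by blast
  then obtain n where n: "coeff q n \<notin> P" by (auto simp: PX_def)
  show ?thesis
  proof (rule that[of "coeff q n"])
    show "coeff q n \<in> A" "coeff q n \<notin> P" using n q(1) by (auto simp: AX_coeff)
  qed (rule extend_hom_transcendental, use True in auto)
next
  case False
  define p where "p = arg_min degree (\<lambda>h. h \<in> AX \<and> poly h x \<in> P \<and> lead_coeff h \<notin> P)"
  have "\<exists>h. h \<in> AX \<and> poly h x \<in> P \<and> lead_coeff h \<notin> P"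
  proof -
    from False obtain h where h: "h \<in> AX" "poly h x \<in> P" "h \<notin> PX" by blast
    from drop_leading_P[OF h(1,3)] obtain h' where h': "h' \<in> AX" "lead_coeff h' \<notin> P" "h - h' \<in> PX" by blast
    have "poly h' x \<in> P" using P_diff[OF h(2) PX_poly[OF h'(3), of x]] by simp
    then show ?thesis using h' by blast
  qed
  then have p_props: "p \<in> AX \<and> poly p x \<in> P \<and> lead_coeff p \<notin> P"
    unfolding p_def by (metis (no_types, lifting) arg_min_natI)
  then have p: "p \<in> AX" "poly p x \<in> P" "lead_coeff p \<notin> P" by auto
  have p_min': "degree p \<le> degree h" if "h \<in> AX" "poly h x \<in> P" "lead_coeff h \<notin> P" for h
    unfolding p_def using that by (intro arg_min_nat_le) auto
  have p_min: "h \<in> PX" if h: "h \<in> AX" "poly h x \<in> P" "degree h < degree p" for h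
  proof (rule ccontr)
    assume "h \<notin> PX"
    from drop_leading_P[OF h(1) this] obtain h' where
      h': "h' \<in> AX" "lead_coeff h' \<notin> P" "h - h' \<in> PX" "degree h' \<le> degree h" by blast
    have "poly h' x \<in> P" using P_diff[OF h(2) PX_poly[OF h'(3), of x]] by simp
    then show False using p_min'[of h'] h' h(3) by auto
  qed
  have p_deg: "degree p > 0"
  proof (rule ccontr)
    assume "\<not> degree p > 0"
    then obtain c where "p = [:c:]" by (metis degree_eq_zeroE not_gr0)
    then show False using p by simp
  qed

  \<comment> \<open>The multiples of \<open>q(x)\<close> that are nonzero modulo \<open>P\<close>, given by polynomials representing them.
    One of least degree turns out to be a constant, which yields the identity of Bezout type.\<close>
  define M where "M = (\<lambda>r. r \<in> AX \<and> poly r x \<notin> P \<and> lead_coeff r \<notin> P \<and>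
      (\<exists>s\<in>AX. poly (r - s * q) x \<in> P))"
  have to_M: "\<exists>r'. M r' \<and> degree r' \<le> degree r"
    if r: "r \<in> AX" "poly r x \<notin> P" "s \<in> AX" "poly (r - s * q) x \<in> P" for r s
  proof -
    have "r \<notin> PX" using r PX_poly by blast
    from drop_leading_P[OF r(1) this] obtain r' where
      r': "r' \<in> AX" "lead_coeff r' \<notin> P" "r - r' \<in> PX" "degree r' \<le> degree r" by blast
    have d: "poly r x - poly r' x \<in> P" using PX_poly[OF r'(3), of x] by simp
    have "poly r' x \<notin> P" using P_add[OF d, of "poly r' x"] r(2) by auto
    moreover have "poly (r' - s * q) x \<in> P"
      using P_diff[OF r(4) d] by (simp add: algebra_simps)
    ultimately show ?thesis using r' r(3) unfolding M_def by blast
  qed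
  define r where "r = arg_min degree M"
  have "\<exists>r. M r" using to_M[of q "[:1:]"] q P_zero by (auto simp: AX_const A_one)
  then have "M r" unfolding r_def by (metis arg_min_natI)
  then obtain s where r: "r \<in> AX" "poly r x \<notin> P" "lead_coeff r \<notin> P"
      and s: "s \<in> AX" "poly (r - s * q) x \<in> P" unfolding M_def by blast
  have r_min: "degree r \<le> degree r'" if "M r'" for r'
    unfolding r_def using that by (rule arg_min_nat_le)
  have r_min': "degree r \<le> degree r'"
    if "r' \<in> AX" "poly r' x \<notin> P" "s' \<in> AX" "poly (r' - s' * q) x \<in> P" for r' s'
    using to_M[OF that] r_min order_trans by blast

  have r_lt: "degree r < degree p"
  proof (rule ccontr)
    assume ge: "\<not> degree r < degree p"
    from pseudo_division[OF p(1) p_deg r(1)] obtain k w r' where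
      w: "w \<in> AX" "r' \<in> AX" "degree r' < degree p" "smult (lead_coeff p ^ k) r = p * w + r'" by blast
    have eq: "poly r' x = lead_coeff p ^ k * poly r x - poly p x * poly w x"
      using arg_cong[OF w(4), of "\<lambda>h. poly h x"] by simp
    have "poly r' x \<notin> P"
    proof
      assume "poly r' x \<in> P"
      then have "lead_coeff p ^ k * poly r x \<in> P"
        using P_add[OF _ P_mult'[OF p(2), of "poly w x"], of "poly r' x"] by (simp add: eq)
      then show False using P_prime[of "lead_coeff p ^ k" "poly r x"] P_power p(3) r(2) by metis
    qed
    moreover have "poly (r' - smult (lead_coeff p ^ k) s * q) x \<in> P"
    proof -
      have "poly (r' - smult (lead_coeff p ^ k) s * q) x =
          lead_coeff p ^ k * poly (r - s * q) x - poly p x * poly w x"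
        by (simp add: eq algebra_simps)
      then show ?thesis using P_diff[OF P_mult[OF s(2)] P_mult'[OF p(2)]] by simp
    qed
    ultimately have "degree r \<le> degree r'"
      using r_min'[of r' "smult (lead_coeff p ^ k) s"] w(2) s(1) p(1)
      by (auto intro!: AX_smult A_power AX_coeff)
    then show False using w(3) ge by simp
  qed

  \<comment> \<open>Otherwise division of \<open>p\<close> by \<open>r\<close> leaves a remainder that is a multiple of \<open>q(x)\<close> of smaller degree,
    hence zero modulo \<open>P\<close>; then the cofactor is a relation for \<open>x\<close> of degree below that of \<open>p\<close>, so it
    vanishes modulo \<open>P\<close>, and with it \<open>p\<close>.\<close>
  have "degree r = 0"
  proof (rule ccontr)
    assume "degree r \<noteq> 0"
    then have "degree r > 0" by simp
    from pseudo_division[OF r(1) this p(1)] obtain k w r' where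
      w: "w \<in> AX" "r' \<in> AX" "degree r' < degree r" "smult (lead_coeff r ^ k) p = r * w + r'" by blast
    have eq: "poly r' x = lead_coeff r ^ k * poly p x - poly r x * poly w x"
      using arg_cong[OF w(4), of "\<lambda>h. poly h x"] by simp
    have r'P: "poly r' x \<in> P"
    proof (rule ccontr)
      assume *: "poly r' x \<notin> P"
      have "poly (r' - (- (w * s)) * q) x =
          lead_coeff r ^ k * poly p x - poly w x * poly (r - s * q) x"
        by (simp add: eq algebra_simps)
      then have **: "poly (r' - (- (w * s)) * q) x \<in> P"
        using P_diff[OF P_mult[OF p(2)] P_mult[OF s(2)]] by simp
      show False using r_min'[OF w(2) * _ **] w(1,3) s(1) by (auto intro: AX_uminus AX_mult)
    qed
    have r'PX: "r' \<in> PX" using p_min[OF w(2) r'P] w(3) r_lt by simp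
    have "poly r x * poly w x \<in> P"
      using P_diff[OF P_mult[OF p(2), of "lead_coeff r ^ k"] r'P] by (simp add: eq)
    then have wP: "poly w x \<in> P" using P_prime[of "poly r x" "poly w x"] r(2) by simp
    have "w \<in> PX"
    proof (cases "w = 0")
      case True
      then show ?thesis by (simp add: PX_def P_zero)
    next
      case False
      have "r \<noteq> 0" using \<open>degree r \<noteq> 0\<close> by auto
      then have "degree r + degree w = degree (r * w)" using False by (simp add: degree_mult_eq)
      also have "r * w = smult (lead_coeff r ^ k) p - r'" using w(4) by simp
      also have "degree \<dots> \<le> degree p"
        using w(3) r_lt by (intro degree_diff_le) (auto simp: degree_smult_le)
      finally have "degree w < degree p" using \<open>degree r > 0\<close> by linarith
      then show ?thesis using p_min[OF w(1) wP] by simp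
    qed
    then have "smult (lead_coeff r ^ k) p \<in> PX" unfolding w(4) using r'PX by (intro PX_add PX_mult)
    then have "lead_coeff r ^ k * lead_coeff p \<in> P" by (simp add: PX_def)
    then show False using P_prime[of "lead_coeff r ^ k" "lead_coeff p"] P_power r(3) p(3) by metis
  qed
  then obtain c where rc: "r = [:c:]" by (metis degree_eq_zeroE)
  have cA: "c \<in> A" and cP: "c \<notin> P" using r AX_coeff[OF r(1), of 0] by (auto simp: rc)
  show ?thesis
  proof (rule that[of "lead_coeff p * c"])
    show "lead_coeff p * c \<in> A" using p(1) cA by (intro A_mult AX_coeff)
    show "lead_coeff p * c \<notin> P" using P_prime[of "lead_coeff p" c] p(3) cP by metis
  next
    fix f :: "'a \<Rightarrow> 'k"
    assume f: "is_ring_hom f" and fP: "\<And>a. a \<in> A \<Longrightarrow> a \<in> P \<Longrightarrow> f a = 0"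
      and fu: "f (lead_coeff p * c) \<noteq> 0"
    note hom = is_ring_homD[OF f]
    have fl: "f (lead_coeff p) \<noteq> 0" "f c \<noteq> 0" using fu by (auto simp: hom)
    have "coeff (map_poly f p) (degree p) \<noteq> 0" using fl by (simp add: coeff_map_poly hom)
    then have "degree (map_poly f p) > 0" using p_deg le_degree by (meson order.strict_trans2)
    then obtain \<xi> where \<xi>: "poly (map_poly f p) \<xi> = 0" using alg_closed_imp_poly_has_root by blast
    have van: "poly (map_poly f h) \<xi> = 0" if h: "h \<in> AX" "poly h x \<in> P" for h
    proof -
      from pseudo_division[OF p(1) p_deg h(1)] obtain k w r' where
        w: "w \<in> AX" "r' \<in> AX" "degree r' < degree p" "smult (lead_coeff p ^ k) h = p * w + r'" by blast
      have "poly r' x = lead_coeff p ^ k * poly h x - poly p x * poly w x"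
        using arg_cong[OF w(4), of "\<lambda>h. poly h x"] by simp
      then have "poly r' x \<in> P" using P_diff[OF P_mult[OF h(2)] P_mult'[OF p(2)]] by simp
      then have "r' \<in> PX" using p_min[OF w(2) _ w(3)] by simp
      then have "map_poly f r' = 0"
        using w(2) fP by (intro poly_eqI) (auto simp: AX_def PX_def coeff_map_poly hom)
      then have "f (lead_coeff p) ^ k * poly (map_poly f h) \<xi> = 0"
        using arg_cong[OF w(4), of "\<lambda>h. poly (map_poly f h) \<xi>"] \<xi> by (simp add: map_poly_hom[OF f] hom)
      then show ?thesis using fl by simp
    qed
    have "poly (map_poly f (r - s * q)) \<xi> = 0" using van[OF AX_diff[OF r(1) AX_mult[OF s(1) q(1)]] s(2)] .
    then have "f c = poly (map_poly f s) \<xi> * poly (map_poly f q) \<xi>"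
      by (simp add: map_poly_hom[OF f] hom rc map_poly_pCons)
    then have "poly (map_poly f q) \<xi> \<noteq> 0" using fl by auto
    then show "\<exists>\<xi>. (\<forall>h\<in>AX. poly h x \<in> P \<longrightarrow> poly (map_poly f h) \<xi> = 0) \<and> poly (map_poly f q) \<xi> \<noteq> 0"
      using van by blast
  qed
qed

end

section \<open>The Nullstellensatz for prime ideals\<close>

lemma mpolys_in_insert:
  assumes "F \<in> mpolys_in (insert j S)"
  shows "\<exists>h. (\<forall>n. coeff h n \<in> mpolys_in S) \<and> F = poly h (mvar j)"
  using assms
proof induction
  case (const c)
  show ?case using mpolys_in.const[of 0 S]
    by (intro exI[of _ "[:mconst c:]"]) (auto simp: coeff_pCons mpolys_in.const mconst_simps split: nat.split)
next
  case (var l)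
  have z: "0 \<in> mpolys_in S" using mpolys_in.const[of 0 S] by (simp add: mconst_simps)
  have o: "1 \<in> mpolys_in S" using mpolys_in.const[of 1 S] by (simp add: mconst_simps)
  show ?case
  proof (cases "l = j")
    case True
    then show ?thesis using z o
      by (intro exI[of _ "[:0, 1:]"]) (auto simp: coeff_pCons split: nat.split)
  next
    case False
    then show ?thesis using z var
      by (intro exI[of _ "[:mvar l:]"]) (auto simp: coeff_pCons mpolys_in.var split: nat.split)
  qed
next
  case (add F G)
  then obtain h h' where "\<forall>n. coeff h n \<in> mpolys_in S" "F = poly h (mvar j)"
    "\<forall>n. coeff h' n \<in> mpolys_in S" "G = poly h' (mvar j)" by blast
  then show ?case by (intro exI[of _ "h + h'"]) (auto intro: mpolys_in.add)
next
  case (mult F G)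
  then obtain h h' where h: "\<forall>n. coeff h n \<in> mpolys_in S" "F = poly h (mvar j)"
    "\<forall>n. coeff h' n \<in> mpolys_in S" "G = poly h' (mvar j)" by blast
  have *: "sum g T \<in> mpolys_in S" if "\<And>s. s \<in> T \<Longrightarrow> g s \<in> mpolys_in S"
    for g :: "nat \<Rightarrow> ('a, 'b) mpoly" and T
    using that mpolys_in.const[of 0 S]
    by (induction T rule: infinite_finite_induct) (auto intro: mpolys_in.add simp: mconst_simps)
  then show ?case using h
    by (intro exI[of _ "h * h'"]) (simp add: coeff_mult * mpolys_in.mult)
qed

lemma meval_cong_mpolys_in:
  assumes "F \<in> mpolys_in S" "\<And>j. j \<in> S \<Longrightarrow> v j = w j"
  shows "meval F v = meval F w"
  using assms by induction auto

lemma primeidealD: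
  fixes I :: "('n::{finite,linorder}, 'k::field) mpoly set"
  assumes "primeideal I mpoly_ring"
  shows "0 \<in> I" "\<And>a b. a \<in> I \<Longrightarrow> b \<in> I \<Longrightarrow> a + b \<in> I" "\<And>a b. b \<in> I \<Longrightarrow> a * b \<in> I"
    "1 \<notin> I" "\<And>a b. a * b \<in> I \<Longrightarrow> a \<in> I \<or> b \<in> I"
proof -
  interpret primeideal I "mpoly_ring :: ('n, 'k) mpoly ring" by fact
  show "0 \<in> I" using additive_subgroup.zero_closed[OF is_additive_subgroup]
    by (simp add: ring_of_type_algebra_def)
  show "a + b \<in> I" if "a \<in> I" "b \<in> I" for a b
    using additive_subgroup.a_closed[OF is_additive_subgroup that] by (simp add: ring_of_type_algebra_def)
  show mult: "a * b \<in> I" if "b \<in> I" for a b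
    using I_l_closed[OF that, of a] by (simp add: ring_of_type_algebra_def)
  show "a \<in> I \<or> b \<in> I" if "a * b \<in> I" for a b
    using I_prime[of a b] that by (simp add: ring_of_type_algebra_def)
  show "1 \<notin> I"
  proof
    assume "1 \<in> I"
    then have "I = UNIV" using mult[of 1] by auto
    then show False using I_notcarr by (simp add: ring_of_type_algebra_def)
  qed
qed

text \<open>
  Induction on the set of variables.  The point sought is a homomorphism to \<open>K\<close> on the subring
  generated by the variables in \<open>S\<close>; as it must avoid the zeros of the element \<open>u\<close> that
  \<open>extend_hom_step\<close> produces, the statement has to speak of an arbitrary \<open>F\<close> outside \<open>I\<close>.
\<close>

lemma nullstellensatz_prime_finite_vars:
  fixes I :: "('n::{finite,linorder}, 'k::alg_closed_field) mpoly set"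
  assumes I: "primeideal I mpoly_ring" and "finite S"
  shows "F \<in> mpolys_in S \<Longrightarrow> F \<notin> I \<Longrightarrow> \<exists>v. meval F v \<noteq> 0 \<and> (\<forall>G \<in> I \<inter> mpolys_in S. meval G v = 0)"
  using assms(2)
proof (induction S arbitrary: F rule: finite_induct)
  case empty
  have ex: "\<exists>c. G = mconst c" if "G \<in> mpolys_in {}" for G :: "('n, 'k) mpoly"
    using that by induction (auto simp flip: mconst_simps)
  from ex[OF empty(1)] obtain c where c: "F = mconst c" by blast
  then have "c \<noteq> 0" using empty primeidealD(1)[OF I] by (auto simp: mconst_simps)
  moreover have "meval G v = 0" if G: "G \<in> I" "G \<in> mpolys_in {}" for G v
  proof -
    from ex[OF G(2)] obtain b where b: "G = mconst b" by blast
    have "b = 0"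
    proof (rule ccontr)
      assume "b \<noteq> 0"
      then have "mconst (1 / b) * G = 1" using b by (simp flip: mconst_simps)
      then show False using primeidealD(3)[OF I G(1), of "mconst (1 / b)"] primeidealD(4)[OF I] by simp
    qed
    then show ?thesis using b by simp
  qed
  ultimately show ?case using c by (intro exI[of _ undefined]) auto
next
  case (insert j S)
  interpret prime_over_subring I "mpolys_in S"
    using primeidealD[OF I] mpolys_in.const[of 0 S] mpolys_in.const[of 1 S]
    by unfold_locales (auto intro: mpolys_in.add mpolys_in.mult mpolys_in_uminus simp: mconst_simps)
  from mpolys_in_insert[OF insert(4)] obtain q where q: "q \<in> AX" "F = poly q (mvar j)"
    unfolding AX_def by blast
  from extend_hom_step[of q "mvar j", where 'k = 'k] q insert obtain u where
    u: "u \<in> mpolys_in S" "u \<notin> I"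
    "\<And>f :: ('n, 'k) mpoly \<Rightarrow> 'k. is_ring_hom f \<Longrightarrow> (\<And>a. a \<in> mpolys_in S \<Longrightarrow> a \<in> I \<Longrightarrow> f a = 0) \<Longrightarrow> f u \<noteq> 0 \<Longrightarrow>
      \<exists>\<xi>. (\<forall>h\<in>AX. poly h (mvar j) \<in> I \<longrightarrow> poly (map_poly f h) \<xi> = 0) \<and> poly (map_poly f q) \<xi> \<noteq> 0"
    by metis
  from insert.IH[OF u(1,2)] obtain v where
    v: "meval u v \<noteq> 0" "\<forall>G\<in>I \<inter> mpolys_in S. meval G v = 0" by blast
  from u(3)[OF is_ring_hom_meval, of v] v obtain \<xi> where
    \<xi>: "\<forall>h\<in>AX. poly h (mvar j) \<in> I \<longrightarrow> poly (map_poly (\<lambda>F. meval F v) h) \<xi> = 0"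
      "poly (map_poly (\<lambda>F. meval F v) q) \<xi> \<noteq> 0" by auto
  have ev: "meval (poly h (mvar j)) (v(j := \<xi>)) = poly (map_poly (\<lambda>F. meval F v) h) \<xi>"
    if "h \<in> AX" for h
  proof -
    have "map_poly (\<lambda>F. meval F (v(j := \<xi>))) h = map_poly (\<lambda>F. meval F v) h"
    proof (rule poly_eqI)
      fix n
      have "meval (coeff h n) (v(j := \<xi>)) = meval (coeff h n) v"
        using that insert(2) by (intro meval_cong_mpolys_in[of _ S]) (auto simp: AX_def)
      then show "coeff (map_poly (\<lambda>F. meval F (v(j := \<xi>))) h) n = coeff (map_poly (\<lambda>F. meval F v) h) n"
        by (simp add: coeff_map_poly)
    qed
    then show ?thesis
      using poly_map_poly_hom[OF is_ring_hom_meval, of h "mvar j" "v(j := \<xi>)"] by simp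
  qed
  have "meval G (v(j := \<xi>)) = 0" if G: "G \<in> I" "G \<in> mpolys_in (insert j S)" for G
  proof -
    from mpolys_in_insert[OF G(2)] obtain h where "h \<in> AX" "G = poly h (mvar j)"
      unfolding AX_def by blast
    then show ?thesis using ev \<xi>(1) G(1) by auto
  qed
  moreover have "meval F (v(j := \<xi>)) \<noteq> 0" using ev[OF q(1)] \<xi>(2) q(2) by (simp only: not_False_eq_True)
  ultimately show ?case by (intro exI[of _ "v(j := \<xi>)"] conjI ballI) (simp_all only: Int_iff not_False_eq_True)
qed

theorem nullstellensatz_prime:
  fixes I :: "('n::{finite,linorder}, 'k::alg_closed_field) mpoly set"
  assumes "primeideal I mpoly_ring"
    and "\<And>v. v \<in> zero_locus I \<Longrightarrow> meval F v = 0"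
  shows "F \<in> I"
proof (rule ccontr)
  assume "F \<notin> I"
  from nullstellensatz_prime_finite_vars[OF assms(1) finite mpolys_in_UNIV this]
  obtain v where v: "meval F v \<noteq> 0" "\<forall>G \<in> I \<inter> mpolys_in UNIV. meval G v = 0"
    by (elim exE conjE)
  have "v \<in> zero_locus I" using v(2) mpolys_in_UNIV unfolding zero_locus_def by blast
  then show False using assms(2) v(1) by blast
qed

section \<open>Residue classes as functions on the variety\<close>

locale affine_variety =
  fixes I :: "('n::{finite,linorder}, 'k::alg_closed_field) mpoly set" and V :: "('n \<Rightarrow> 'k) set"
  assumes prime: "primeideal I mpoly_ring" and V: "V = zero_locus I"
begin

lemma mem_ideal_iff: "F \<in> I \<longleftrightarrow> (\<forall>v\<in>V. meval F v = 0)"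
  using nullstellensatz_prime[OF prime, of F] unfolding V by (auto simp: zero_locus_def)

lemma residue_class_eq: "residue_class I F = {H + F |H. H \<in> I}"
  by (auto simp: a_r_coset_def r_coset_def ring_of_type_algebra_def)

lemma self_mem_residue_class: "F \<in> residue_class I F"
  using primeidealD(1)[OF prime] unfolding residue_class_eq by force

lemma meval_residue_class: "G \<in> residue_class I F \<Longrightarrow> v \<in> V \<Longrightarrow> meval G v = meval F v"
  by (auto simp: residue_class_eq mem_ideal_iff)

lemma residue_class_eq_iff: "residue_class I F = residue_class I G \<longleftrightarrow> (\<forall>v\<in>V. meval F v = meval G v)"
proof
  assume "residue_class I F = residue_class I G"
  then have "F \<in> residue_class I G" using self_mem_residue_class[of F] by simp
  then show "\<forall>v\<in>V. meval F v = meval G v" by (intro ballI meval_residue_class)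
next
  have sub: "residue_class I F \<subseteq> residue_class I G" if "\<forall>v\<in>V. meval F v = meval G v" for F G
  proof
    fix H assume "H \<in> residue_class I F"
    then have "H - G \<in> I" using that meval_residue_class by (auto simp: mem_ideal_iff)
    then show "H \<in> residue_class I G" unfolding residue_class_eq by (auto intro!: exI[of _ "H - G"])
  qed
  assume "\<forall>v\<in>V. meval F v = meval G v"
  then show "residue_class I F = residue_class I G" using sub[of F G] sub[of G F] by auto
qed

lemma coord_eval_residue_class [simp]: "v \<in> V \<Longrightarrow> coord_eval (residue_class I F) v = meval F v"
proof -
  assume v: "v \<in> V"
  have "(\<lambda>G. meval G v) ` residue_class I F = {meval F v}"
  proof (intro equalityI subsetI)
    fix c assume "c \<in> (\<lambda>G. meval G v) ` residue_class I F"
    then show "c \<in> {meval F v}" using meval_residue_class[OF _ v] by (elim imageE) simp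
  next
    fix c assume "c \<in> {meval F v}"
    then show "c \<in> (\<lambda>G. meval G v) ` residue_class I F" using self_mem_residue_class[of F] by simp
  qed
  then show ?thesis by (simp add: coord_eval_def)
qed

lemma carrier_coord_ring: "carrier (coord_ring I) = range (residue_class I)"
  by (auto simp: FactRing_def A_RCOSETS_def RCOSETS_def a_r_coset_def ring_of_type_algebra_def)

lemma coord_ring_simps:
  "residue_class I F \<otimes>\<^bsub>coord_ring I\<^esub> residue_class I G = residue_class I (F * G)"
  "residue_class I F \<oplus>\<^bsub>coord_ring I\<^esub> residue_class I G = residue_class I (F + G)"
  "\<one>\<^bsub>coord_ring I\<^esub> = residue_class I 1"
  "\<zero>\<^bsub>coord_ring I\<^esub> = residue_class I 0"
proof -
  have car: "x \<in> carrier mpoly_ring" for x :: "('n, 'k) mpoly" by (simp add: ring_of_type_algebra_def)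
  note rcos = ideal.rcos_ring_hom[OF primeideal.axioms(1)[OF prime]]
  note hom = ring_hom_mult[OF rcos car car] ring_hom_add[OF rcos car car]
    ring_hom_one[OF rcos]
  show "residue_class I F \<otimes>\<^bsub>coord_ring I\<^esub> residue_class I G = residue_class I (F * G)"
    "residue_class I F \<oplus>\<^bsub>coord_ring I\<^esub> residue_class I G = residue_class I (F + G)"
    "\<one>\<^bsub>coord_ring I\<^esub> = residue_class I 1"
    using hom(1)[of F G] hom(2)[of F G] hom(3) by (simp_all add: ring_of_type_algebra_def)
  have "residue_class I 0 = I" by (simp add: residue_class_eq)
  then show "\<zero>\<^bsub>coord_ring I\<^esub> = residue_class I 0" by (simp add: FactRing_def)
qed

lemma coord_ring_pow: "residue_class I F [^]\<^bsub>coord_ring I\<^esub> (n::nat) = residue_class I (F ^ n)"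
  by (induction n) (simp_all add: nat_pow_def coord_ring_simps mult.commute)

end

section \<open>Localization as a ring of functions on a principal open set\<close>

locale principal_open = affine_variety I V
  for I :: "('n::{finite,linorder}, 'k::alg_closed_field) mpoly set" and V :: "('n \<Rightarrow> 'k) set" +
  fixes A :: "('n, 'k) mpoly"
  assumes A_notin: "A \<notin> I"
begin

abbreviation "KX \<equiv> coord_ring I"
abbreviation "rc \<equiv> residue_class I"
abbreviation "KXa \<equiv> localization KX (rc A)"
abbreviation frac :: "('n, 'k) mpoly \<Rightarrow> nat \<Rightarrow> (('n, 'k) mpoly set \<times> nat) set" where
  "frac F m \<equiv> loc_frac KX (rc A) (rc F) m"

definition D :: "('n \<Rightarrow> 'k) set" where "D = {v \<in> V. meval A v \<noteq> 0}"

lemma D_D: "v \<in> D \<Longrightarrow> v \<in> V" "v \<in> D \<Longrightarrow> meval A v \<noteq> 0"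
  by (auto simp: D_def)

text \<open>
  A polynomial vanishing on \<open>D\<close> vanishes on all of \<open>V\<close> after multiplication with \<open>A\<close>, which can be
  cancelled modulo the prime ideal \<open>I\<close>.
\<close>

lemma residue_class_eq_iff_D: "rc F = rc G \<longleftrightarrow> (\<forall>v\<in>D. meval F v = meval G v)"
proof
  assume "\<forall>v\<in>D. meval F v = meval G v"
  then have "A * (F - G) \<in> I" by (auto simp: mem_ideal_iff D_def)
  then have "F - G \<in> I" using primeidealD(5)[OF prime] A_notin by blast
  then show "rc F = rc G" by (simp add: residue_class_eq_iff mem_ideal_iff)
qed (auto simp: residue_class_eq_iff D_def)

text \<open>
  The class of fractions \<open>s / a\<^sup>n\<close> with values \<open>f\<close> on \<open>D\<close>.  Regular functions on \<open>D\<close> are mapped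
  isomorphically onto the localization, so that computations there become computations with functions.
\<close>

definition fraction_of :: "(('n \<Rightarrow> 'k) \<Rightarrow> 'k) \<Rightarrow> (('n, 'k) mpoly set \<times> nat) set" where
  "fraction_of f =
    {(s, n). s \<in> carrier KX \<and> (\<forall>v\<in>D. coord_eval s v = f v * meval A v ^ n)}"

definition regular :: "(('n \<Rightarrow> 'k) \<Rightarrow> 'k) \<Rightarrow> bool" where
  "regular f \<longleftrightarrow> (\<exists>F m. \<forall>v\<in>D. f v = meval F v / meval A v ^ m)"

lemma mem_fraction_of: "(rc G, n) \<in> fraction_of f \<longleftrightarrow> (\<forall>v\<in>D. meval G v = f v * meval A v ^ n)"
  by (simp add: fraction_of_def D_def carrier_coord_ring)

lemma fraction_of_cong: "(\<And>v. v \<in> D \<Longrightarrow> f v = f' v) \<Longrightarrow> fraction_of f = fraction_of f'"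
  by (auto simp: fraction_of_def)

lemma frac_eq: "frac F m = fraction_of (\<lambda>v. meval F v / meval A v ^ m)"
proof -
  have "(s, n) \<in> frac F m \<longleftrightarrow> (s, n) \<in> fraction_of (\<lambda>v. meval F v / meval A v ^ m)" for s n
  proof (cases "s \<in> carrier KX")
    case True
    then obtain G where G: "s = rc G" by (auto simp: carrier_coord_ring)
    have "(s, n) \<in> frac F m \<longleftrightarrow> (\<exists>k. rc (A ^ k * (F * A ^ n)) = rc (A ^ k * (G * A ^ m)))"
      using True by (simp add: loc_frac_def G coord_ring_simps coord_ring_pow)
    also have "\<dots> \<longleftrightarrow> (\<forall>v\<in>D. meval F v * meval A v ^ n = meval G v * meval A v ^ m)"
      by (auto simp: residue_class_eq_iff_D D_D)
    also have "\<dots> \<longleftrightarrow> (s, n) \<in> fraction_of (\<lambda>v. meval F v / meval A v ^ m)"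
      unfolding G mem_fraction_of by (intro ball_cong refl) (auto simp: D_D field_simps)
    finally show ?thesis .
  next
    case False
    then show ?thesis by (simp add: loc_frac_def fraction_of_def)
  qed
  then show ?thesis by auto
qed

lemma regular_frac: "regular (\<lambda>v. meval F v / meval A v ^ m)"
  by (auto simp: regular_def)

lemma regular_meval: "regular (meval F)"
  using regular_frac[of F 0] by simp

lemma regular_cong: "regular f \<Longrightarrow> (\<And>v. v \<in> D \<Longrightarrow> f v = f' v) \<Longrightarrow> regular f'"
  by (simp add: regular_def)

lemma regular_add: "regular (\<lambda>v. f v + f' v)" if "regular f" "regular f'"
proof -
  from that obtain F m F' m' where "\<forall>v\<in>D. f v = meval F v / meval A v ^ m"
    "\<forall>v\<in>D. f' v = meval F' v / meval A v ^ m'" unfolding regular_def by blast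
  then have "\<forall>v\<in>D. f v + f' v = meval (F * A ^ m' + F' * A ^ m) v / meval A v ^ (m + m')"
    by (auto simp: D_D power_add add_frac_eq)
  then show ?thesis unfolding regular_def by blast
qed

lemma regular_mult: "regular (\<lambda>v. f v * f' v)" if "regular f" "regular f'"
proof -
  from that obtain F m F' m' where "\<forall>v\<in>D. f v = meval F v / meval A v ^ m"
    "\<forall>v\<in>D. f' v = meval F' v / meval A v ^ m'" unfolding regular_def by blast
  then have "\<forall>v\<in>D. f v * f' v = meval (F * F') v / meval A v ^ (m + m')"
    by (auto simp: power_add)
  then show ?thesis unfolding regular_def by blast
qed

lemma regular_uminus: "regular (\<lambda>v. - f v)" if "regular f"
  using regular_mult[OF regular_meval[of "- 1"] that] by simp

lemma regular_inverse_A: "regular (\<lambda>v. 1 / meval A v ^ n)"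
  using regular_frac[of 1 n] by simp

lemma fraction_of_eq_iff:
  assumes "regular f"
  shows "fraction_of f = fraction_of f' \<longleftrightarrow> (\<forall>v\<in>D. f v = f' v)"
proof
  assume eq: "fraction_of f = fraction_of f'"
  from assms obtain F m where F: "\<forall>v\<in>D. f v = meval F v / meval A v ^ m"
    unfolding regular_def by blast
  then have "(rc F, m) \<in> fraction_of f" by (auto simp: mem_fraction_of D_D)
  then have "\<forall>v\<in>D. meval F v = f' v * meval A v ^ m" unfolding eq mem_fraction_of .
  with F show "\<forall>v\<in>D. f v = f' v" by (auto simp: D_D)
qed (rule fraction_of_cong, blast)

lemma carrier_localization: "carrier KXa = fraction_of ` Collect regular"
proof -
  have "carrier KXa = {frac F m |F m. True}"
    by (force simp: localization_def carrier_coord_ring)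
  also have "\<dots> = fraction_of ` Collect regular"
  proof
    show "{frac F m |F m. True} \<subseteq> fraction_of ` Collect regular"
      using regular_frac by (auto simp: frac_eq)
    show "fraction_of ` Collect regular \<subseteq> {frac F m |F m. True}"
    proof
      fix u assume "u \<in> fraction_of ` Collect regular"
      then obtain f where f: "u = fraction_of f" "regular f" by blast
      then obtain F m where F: "\<forall>v\<in>D. f v = meval F v / meval A v ^ m"
        unfolding regular_def by blast
      have "u = frac F m" unfolding frac_eq f(1) by (rule fraction_of_cong) (use F in simp)
      then show "u \<in> {frac F m |F m. True}" by blast
    qed
  qed
  finally show ?thesis .
qed

lemma fraction_of_pairs:
  assumes "regular f"
  shows "fraction_of f \<noteq> {}"
    and "x \<in> fraction_of f \<Longrightarrow> \<exists>F m. x = (rc F, m) \<and> (\<forall>v\<in>D. f v = meval F v / meval A v ^ m)"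
proof -
  from assms obtain F m where F: "\<forall>v\<in>D. f v = meval F v / meval A v ^ m"
    unfolding regular_def by blast
  then have "(rc F, m) \<in> fraction_of f" by (auto simp: mem_fraction_of D_D)
  then show "fraction_of f \<noteq> {}" by blast
  assume x: "x \<in> fraction_of f"
  obtain s m where sm: "x = (s, m)" by (cases x)
  with x obtain F where F: "s = rc F" by (auto simp: fraction_of_def carrier_coord_ring)
  from x have "\<forall>v\<in>D. meval F v = f v * meval A v ^ m" unfolding sm F mem_fraction_of .
  then have "\<forall>v\<in>D. f v = meval F v / meval A v ^ m" by (auto simp: D_D)
  then show "\<exists>F m. x = (rc F, m) \<and> (\<forall>v\<in>D. f v = meval F v / meval A v ^ m)"
    unfolding sm F by blast
qed

lemma localization_mult:
  assumes "regular f" "regular f'"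
  shows "fraction_of f \<otimes>\<^bsub>KXa\<^esub> fraction_of f' = fraction_of (\<lambda>v. f v * f' v)"
proof -
  have "loc_frac KX (rc A) (r \<otimes>\<^bsub>KX\<^esub> s) (m + n) = fraction_of (\<lambda>v. f v * f' v)"
    if x: "(r, m) \<in> fraction_of f" and y: "(s, n) \<in> fraction_of f'" for r m s n
  proof -
    from fraction_of_pairs(2)[OF assms(1) x] obtain F where
      F: "r = rc F" "\<forall>v\<in>D. f v = meval F v / meval A v ^ m" by auto
    from fraction_of_pairs(2)[OF assms(2) y] obtain G where
      G: "s = rc G" "\<forall>v\<in>D. f' v = meval G v / meval A v ^ n" by auto
    show ?thesis unfolding F(1) G(1) coord_ring_simps frac_eq
      by (rule fraction_of_cong) (use F(2) G(2) in \<open>auto simp: power_add\<close>)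
  qed
  then have "fraction_of f \<otimes>\<^bsub>KXa\<^esub> fraction_of f' =
      (\<Union>x\<in>fraction_of f. \<Union>y\<in>fraction_of f'. fraction_of (\<lambda>v. f v * f' v))"
    unfolding localization_def by (auto simp: split_beta)
  then show ?thesis using fraction_of_pairs(1)[OF assms(1)] fraction_of_pairs(1)[OF assms(2)] by simp
qed

lemma localization_add:
  assumes "regular f" "regular f'"
  shows "fraction_of f \<oplus>\<^bsub>KXa\<^esub> fraction_of f' = fraction_of (\<lambda>v. f v + f' v)"
proof -
  have "loc_frac KX (rc A) (r \<otimes>\<^bsub>KX\<^esub> rc A [^]\<^bsub>KX\<^esub> n \<oplus>\<^bsub>KX\<^esub> s \<otimes>\<^bsub>KX\<^esub> rc A [^]\<^bsub>KX\<^esub> m) (m + n) =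
      fraction_of (\<lambda>v. f v + f' v)"
    if x: "(r, m) \<in> fraction_of f" and y: "(s, n) \<in> fraction_of f'" for r m s n
  proof -
    from fraction_of_pairs(2)[OF assms(1) x] obtain F where
      F: "r = rc F" "\<forall>v\<in>D. f v = meval F v / meval A v ^ m" by auto
    from fraction_of_pairs(2)[OF assms(2) y] obtain G where
      G: "s = rc G" "\<forall>v\<in>D. f' v = meval G v / meval A v ^ n" by auto
    show ?thesis unfolding F(1) G(1) coord_ring_simps coord_ring_pow frac_eq
      by (rule fraction_of_cong) (use F(2) G(2) in \<open>auto simp: power_add D_D add_frac_eq\<close>)
  qed
  then have "fraction_of f \<oplus>\<^bsub>KXa\<^esub> fraction_of f' =
      (\<Union>x\<in>fraction_of f. \<Union>y\<in>fraction_of f'. fraction_of (\<lambda>v. f v + f' v))"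
    unfolding localization_def by (auto simp: split_beta)
  then show ?thesis using fraction_of_pairs(1)[OF assms(1)] fraction_of_pairs(1)[OF assms(2)] by simp
qed

lemma localization_one: "\<one>\<^bsub>KXa\<^esub> = fraction_of (\<lambda>v. 1)"
  using frac_eq[of 1 0] by (simp add: localization_def coord_ring_simps)

lemma localization_zero: "\<zero>\<^bsub>KXa\<^esub> = fraction_of (\<lambda>v. 0)"
  using frac_eq[of 0 0] by (simp add: localization_def coord_ring_simps)

lemma regular_const: "regular (\<lambda>v. c)"
  using regular_frac[of "mconst c" 0] by simp

text \<open>
  Generated subrings are closed under \<open>\<ominus>\<close>, which is known to be the additive inverse only in an
  abelian group.
\<close>

lemma abelian_group_localization: "abelian_group KXa"
proof (rule abelian_groupI)
  fix x y z assume "x \<in> carrier KXa" "y \<in> carrier KXa" "z \<in> carrier KXa"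
  then obtain f f' f'' where f: "regular f" "regular f'" "regular f''" and
    xyz: "x = fraction_of f" "y = fraction_of f'" "z = fraction_of f''"
    unfolding carrier_localization by blast
  show "x \<oplus>\<^bsub>KXa\<^esub> y \<oplus>\<^bsub>KXa\<^esub> z = x \<oplus>\<^bsub>KXa\<^esub> (y \<oplus>\<^bsub>KXa\<^esub> z)"
    unfolding xyz using f by (simp add: localization_add regular_add add.assoc)
next
  fix x y assume "x \<in> carrier KXa" "y \<in> carrier KXa"
  then obtain f f' where f: "regular f" "regular f'" and
    xyz: "x = fraction_of f" "y = fraction_of f'"
    unfolding carrier_localization by blast
  show "x \<oplus>\<^bsub>KXa\<^esub> y = y \<oplus>\<^bsub>KXa\<^esub> x"
    unfolding xyz using f by (simp add: localization_add add.commute)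
  show "x \<oplus>\<^bsub>KXa\<^esub> y \<in> carrier KXa"
    unfolding xyz carrier_localization using f by (simp add: localization_add regular_add)
next
  fix x assume "x \<in> carrier KXa"
  then obtain f where f: "regular f" "x = fraction_of f" unfolding carrier_localization by blast
  show "\<zero>\<^bsub>KXa\<^esub> \<oplus>\<^bsub>KXa\<^esub> x = x"
    using f by (simp add: localization_add localization_zero regular_const)
  have "fraction_of (\<lambda>v. - f v) \<oplus>\<^bsub>KXa\<^esub> x = \<zero>\<^bsub>KXa\<^esub>"
    using f by (simp add: localization_add localization_zero regular_uminus)
  then show "\<exists>y\<in>carrier KXa. y \<oplus>\<^bsub>KXa\<^esub> x = \<zero>\<^bsub>KXa\<^esub>"
    unfolding carrier_localization using f by (auto intro!: bexI[of _ "fraction_of (\<lambda>v. - f v)"] regular_uminus)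
next
  show "\<zero>\<^bsub>KXa\<^esub> \<in> carrier KXa"
    by (simp add: localization_zero carrier_localization regular_const)
qed

lemma localization_uminus:
  assumes "regular f"
  shows "\<ominus>\<^bsub>KXa\<^esub> fraction_of f = fraction_of (\<lambda>v. - f v)"
proof -
  have "fraction_of (\<lambda>v. - f v) \<oplus>\<^bsub>KXa\<^esub> fraction_of f = \<zero>\<^bsub>KXa\<^esub>"
    using assms by (simp add: localization_add localization_zero regular_uminus)
  then show ?thesis using assms
    by (intro abelian_group.minus_equality[OF abelian_group_localization])
      (auto simp: carrier_localization regular_uminus)
qed

lemma localization_pow:
  assumes "regular f"
  shows "regular (\<lambda>v. f v ^ n)" "fraction_of f [^]\<^bsub>KXa\<^esub> n = fraction_of (\<lambda>v. f v ^ n)"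
proof -
  show *: "regular (\<lambda>v. f v ^ n)" for n
    by (induction n) (auto intro: regular_mult assms regular_const)
  show "fraction_of f [^]\<^bsub>KXa\<^esub> n = fraction_of (\<lambda>v. f v ^ n)"
    by (induction n) (simp_all add: nat_pow_def localization_one localization_mult assms * mult.commute)
qed

end

section \<open>The slice of an additive group action\<close>

lemma mconst_of_nat: "mconst (of_nat m) = (of_nat m :: ('n, 'k::comm_ring_1) mpoly)"
  by (induction m) (simp_all add: mconst_simps)

lemma to_fract_power: "to_fract (x ^ m) = to_fract x ^ m"
  by (induction m) simp_all

lemma to_fract_of_nat: "to_fract (of_nat m) = of_nat m"
  by (induction m) simp_all

lemma coeff_translate:
  fixes p :: "'a::comm_ring_1 poly"
  assumes "degree p \<le> Suc m"
  shows "coeff (pcompose p [:t, 1:]) (Suc m) = coeff p (Suc m)"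
    and "coeff (pcompose p [:t, 1:]) m = coeff p m + of_nat (Suc m) * t * coeff p (Suc m)"
proof -
  have mono: "pcompose (monom b k) q = smult b (q ^ k)" for b :: 'a and q k
    by (induction k) (simp_all add: monom_0 monom_Suc pcompose_pCons mult.commute)
  have p: "pcompose p [:t, 1:] = (\<Sum>k\<le>Suc m. smult (coeff p k) ([:t, 1:] ^ k))"
  proof -
    have "p = (\<Sum>k\<le>Suc m. monom (coeff p k) k)"
      by (rule poly_as_sum_of_monoms'[OF assms, symmetric])
    then have "pcompose p [:t, 1:] = pcompose (\<Sum>k\<le>Suc m. monom (coeff p k) k) [:t, 1:]" by simp
    also have "\<dots> = (\<Sum>k\<le>Suc m. smult (coeff p k) ([:t, 1:] ^ k))"
      by (simp only: pcompose_sum mono)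
    finally show ?thesis .
  qed
  have c: "coeff (pcompose p [:t, 1:]) n =
      (\<Sum>k\<le>Suc m. coeff p k * (of_nat (k choose n) * t ^ (k - n)))" for n
  proof -
    have "coeff ([:t, 1:] ^ k) n = of_nat (k choose n) * t ^ (k - n)" for k
    proof (cases "n \<le> k")
      case True
      then show ?thesis by (simp add: coeff_linear_poly_power)
    next
      case False
      then have "degree ([:t, 1:] ^ k) < n"
        using degree_power_le[of "[:t, 1:]" k] by simp
      then show ?thesis using False by (simp add: coeff_eq_0 binomial_eq_0)
    qed
    then show ?thesis by (simp add: p coeff_sum del: sum.atMost_Suc)
  qed
  have z: "(\<Sum>k<n. coeff p k * (of_nat (k choose n) * t ^ (k - n))) = 0" for n
    by (intro sum.neutral) (auto simp: binomial_eq_0)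
  show "coeff (pcompose p [:t, 1:]) (Suc m) = coeff p (Suc m)"
    using z[of "Suc m"] by (simp add: c lessThan_Suc_atMost)
  show "coeff (pcompose p [:t, 1:]) m = coeff p m + of_nat (Suc m) * t * coeff p (Suc m)"
    using z[of m] by (simp add: c lessThan_Suc_atMost[symmetric] mult_ac binomial_symmetric)
qed

locale Ga_slice = affine_variety I V
  for I :: "('n::{finite,linorder}, 'k::alg_closed_field) mpoly set" and V :: "('n \<Rightarrow> 'k) set" +
  fixes g :: "'n \<Rightarrow> ('n, 'k) mpoly poly" and i :: 'n
  assumes action: "Ga_action_on V g"
    and lead_notin: "lead_coeff (g i) \<notin> I"
    and char: "\<not> CHAR('k) dvd degree (g i)"
begin

abbreviation "A0 \<equiv> top_coeff (g i) 0"
abbreviation "A1 \<equiv> top_coeff (g i) 1"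
abbreviation "d \<equiv> degree (g i)"
abbreviation "mv \<equiv> Ga_move g"

sublocale principal_open I V A0
  using lead_notin by unfold_locales (simp add: top_coeff_def)

lemma d_pos: "d > 0" and d_nonzero: "(of_nat d :: 'k) \<noteq> 0"
proof -
  show "(of_nat d :: 'k) \<noteq> 0" using char of_nat_eq_0_iff_char_dvd by blast
  then show "d > 0" using of_nat_0 by (metis gr0I)
qed

lemma move_closed: "v \<in> V \<Longrightarrow> mv t v \<in> V"
  and move_add: "v \<in> V \<Longrightarrow> mv (s + t) v = mv s (mv t v)"
proof -
  interpret act: group_action "add_monoid (ring_of_type_algebra :: 'k ring)" V "\<lambda>t. \<lambda>v\<in>V. mv t v"
    using action by (simp add: Ga_action_on_def)
  have car: "t \<in> carrier (add_monoid (ring_of_type_algebra :: 'k ring))" for t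
    by (simp add: ring_of_type_algebra_def)
  show closed: "mv t v \<in> V" if "v \<in> V" for t v
    using act.element_image[OF car[of t] that refl] that by simp
  show "mv (s + t) v = mv s (mv t v)" if "v \<in> V" for s t v
    using act.composition_rule[OF that car[of s] car[of t]] that closed[OF that]
    by (simp add: ring_of_type_algebra_def)
qed

definition orbit_poly :: "'n \<Rightarrow> ('n \<Rightarrow> 'k) \<Rightarrow> 'k poly" where
  "orbit_poly j v = map_poly (\<lambda>c. meval c v) (g j)"

lemma poly_orbit_poly: "poly (orbit_poly j v) t = mv t v j"
  by (simp add: Ga_move_def orbit_poly_def)

text \<open>
  This is the group law \<open>s \<cdot> (t \<cdot> v) = (s + t) \<cdot> v\<close>; it holds for all \<open>s\<close> in the infinite field \<open>K\<close>,
  hence as an identity of polynomials in \<open>s\<close>.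
\<close>

lemma orbit_poly_move:
  assumes "v \<in> V"
  shows "orbit_poly j (mv t v) = pcompose (orbit_poly j v) [:t, 1:]"
proof (rule poly_ext)
  fix s
  show "poly (orbit_poly j (mv t v)) s = poly (pcompose (orbit_poly j v) [:t, 1:]) s"
    using move_add[OF assms, of s t] by (simp add: poly_orbit_poly poly_pcompose add.commute)
qed

text \<open>
  At a point where \<open>a\<close> vanishes, the degree of \<open>g\<^sub>i(v, z)\<close> in \<open>z\<close> is smaller than \<open>d\<close>.  The comparison is
  therefore of the coefficients of \<open>z ^ d\<close> and \<open>z ^ (d - 1)\<close>, not of leading coefficients.
\<close>

lemma A0_move: "v \<in> V \<Longrightarrow> meval A0 (mv t v) = meval A0 v"
  and A1_move: "v \<in> V \<Longrightarrow> meval A1 (mv t v) = meval A1 v + of_nat d * t * meval A0 v"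
proof -
  assume v: "v \<in> V"
  obtain m where m: "d = Suc m" using d_pos by (cases d) auto
  have deg: "degree (orbit_poly i v) \<le> Suc m"
    unfolding orbit_poly_def m[symmetric] by (rule map_poly_degree_leq)
  have co: "coeff (orbit_poly i w) d = meval A0 w" "coeff (orbit_poly i w) m = meval A1 w" for w
    by (simp_all add: orbit_poly_def coeff_map_poly top_coeff_def m)
  note tr = coeff_translate[OF deg, of t, folded orbit_poly_move[OF v] m, unfolded co]
  show "meval A0 (mv t v) = meval A0 v" by (rule tr(1))
  show "meval A1 (mv t v) = meval A1 v + of_nat d * t * meval A0 v" by (rule tr(2))
qed

definition slice :: "('n \<Rightarrow> 'k) \<Rightarrow> 'k" where
  "slice v = - meval A1 v / (of_nat d * meval A0 v)"

definition proj :: "('n \<Rightarrow> 'k) \<Rightarrow> 'n \<Rightarrow> 'k" where "proj v = mv (slice v) v"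

lemma move_D: "v \<in> D \<Longrightarrow> mv t v \<in> D"
  by (simp add: D_def A0_move move_closed)

lemma proj_D: "v \<in> D \<Longrightarrow> proj v \<in> D"
  by (simp add: proj_def move_D)

lemma slice_move: "v \<in> D \<Longrightarrow> slice (mv t v) = slice v - t"
  using d_nonzero by (simp add: slice_def A0_move A1_move D_D field_simps del: One_nat_def)

lemma proj_move:
  assumes "v \<in> D"
  shows "proj (mv t v) = proj v"
  using move_add[OF D_D(1)[OF assms], of "slice v - t" t] by (simp add: proj_def slice_move assms)

lemma ex_pullback: "\<exists>G. \<forall>v. meval G v = meval F (mv t v)"
  using mpolys_in_UNIV[of F]
proof induction
  case (const c)
  show ?case by (intro exI[of _ "mconst c"]) simp
next
  case (var j)
  show ?case
  proof (intro exI allI)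
    fix v
    show "meval (poly (g j) (mconst t)) v = meval (mvar j) (mv t v)"
      using poly_map_poly_hom[OF is_ring_hom_meval, of "g j" "mconst t" v] by (simp add: Ga_move_def)
  qed
next
  case (add F G)
  then obtain F' G' where "\<forall>v. meval F' v = meval F (mv t v)" "\<forall>v. meval G' v = meval G (mv t v)" by blast
  then show ?case by (intro exI[of _ "F' + G'"]) simp
next
  case (mult F G)
  then obtain F' G' where "\<forall>v. meval F' v = meval F (mv t v)" "\<forall>v. meval G' v = meval G (mv t v)" by blast
  then show ?case by (intro exI[of _ "F' * G'"]) simp
qed

text \<open>
  The translate of a residue class is specified by its values, so it exists because translates of
  polynomial functions are polynomial, and is unique by the Nullstellensatz.
\<close>

lemma Ga_invariants_iff:
  "rc F \<in> Ga_invariants V I g \<longleftrightarrow> (\<forall>t. \<forall>v\<in>V. meval F (mv t v) = meval F v)"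
proof -
  have "Ga_act V I g t (rc F) = rc F \<longleftrightarrow> (\<forall>v\<in>V. meval F (mv (- t) v) = meval F v)" for t
  proof -
    obtain G where G: "\<forall>v. meval G v = meval F (mv (- t) v)" using ex_pullback by blast
    have "Ga_act V I g t (rc F) = rc G"
      unfolding Ga_act_def
    proof (rule the_equality)
      show "rc G \<in> carrier KX \<and> (\<forall>v\<in>V. coord_eval (rc G) v = coord_eval (rc F) (mv (- t) v))"
        by (simp add: carrier_coord_ring G move_closed)
    next
      fix h assume h: "h \<in> carrier KX \<and> (\<forall>v\<in>V. coord_eval h v = coord_eval (rc F) (mv (- t) v))"
      then obtain H where H: "h = rc H" by (auto simp: carrier_coord_ring)
      have "\<forall>v\<in>V. meval H v = meval G v" using h unfolding H by (simp add: G move_closed)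
      then show "h = rc G" unfolding H residue_class_eq_iff .
    qed
    then show ?thesis by (simp add: residue_class_eq_iff G)
  qed
  then have "rc F \<in> Ga_invariants V I g \<longleftrightarrow> (\<forall>t. \<forall>v\<in>V. meval F (mv (- t) v) = meval F v)"
    by (simp add: Ga_invariants_def carrier_coord_ring)
  also have "\<dots> \<longleftrightarrow> (\<forall>t. \<forall>v\<in>V. meval F (mv t v) = meval F v)"
    by (metis minus_minus)
  finally show ?thesis .
qed

text \<open>
  Invariance extends from \<open>D\<close> to \<open>V\<close> because \<open>D\<close> is dense in \<open>V\<close>.
\<close>

lemma Ga_invariants_iff_D:
  "rc F \<in> Ga_invariants V I g \<longleftrightarrow> (\<forall>t. \<forall>v\<in>D. meval F (mv t v) = meval F v)"
proof
  assume inv: "\<forall>t. \<forall>v\<in>D. meval F (mv t v) = meval F v"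
  have "meval F (mv t v) = meval F v" if v: "v \<in> V" for t v
  proof -
    obtain G where G: "\<forall>v. meval G v = meval F (mv t v)" using ex_pullback by blast
    then have "rc G = rc F" using inv by (simp add: residue_class_eq_iff_D)
    then show ?thesis using v G by (simp add: residue_class_eq_iff)
  qed
  then show "rc F \<in> Ga_invariants V I g" by (simp add: Ga_invariants_iff)
qed (simp add: Ga_invariants_iff D_D)

text \<open>
  The polynomial \<open>a ^ d\<^sub>j h\<^sub>j\<close>: the power of \<open>a\<close> clears the denominators that arise when the slice
  is substituted for \<open>z\<close> in \<open>g\<^sub>j\<close>.
\<close>

definition B :: "'n \<Rightarrow> ('n, 'k) mpoly" where
  "B j = (\<Sum>k\<le>degree (g j). coeff (g j) k * (mconst (- 1 / of_nat d) * A1) ^ k * A0 ^ (degree (g j) - k))"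

lemma to_fract_B: "to_fract (B j) = to_fract A0 ^ degree (g j) * slice_subst g i j"
proof -
  let ?a = "to_fract A0" and ?y = "to_fract (mconst (- 1 / of_nat d) * A1)"
  have a: "?a \<noteq> 0" using A_notin primeidealD(1)[OF prime] by auto
  have "of_nat d * (mconst (- 1 / of_nat d) :: ('n, 'k) mpoly) = mconst (of_nat d * (- 1 / of_nat d))"
    by (simp only: mconst_simps mconst_of_nat)
  also have "\<dots> = mconst (- 1)" using d_nonzero by simp
  also have "\<dots> = - 1"
    using mconst_simps(3)[of "- 1" "1::'k"] by (simp add: mconst_simps eq_neg_iff_add_eq_0)
  finally have "of_nat d * to_fract (mconst (- 1 / of_nat d) :: ('n, 'k) mpoly) = - 1"
    using to_fract_mult[of "of_nat d" "mconst (- 1 / of_nat d) :: ('n, 'k) mpoly"]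
    by (simp add: to_fract_of_nat)
  note c = this
  then have nd: "(of_nat d :: ('n, 'k) mpoly fract) \<noteq> 0" by force
  have "to_fract (mconst (- 1 / of_nat d) :: ('n, 'k) mpoly) = - 1 / of_nat d"
    unfolding c[symmetric] using nd by simp
  then have "?y = - 1 / of_nat d * to_fract A1" by (simp only: to_fract_mult)
  then have x: "- to_fract A1 / (of_nat d * ?a) = ?y / ?a" by simp
  have "?a ^ degree (g j) * slice_subst g i j =
      (\<Sum>k\<le>degree (g j). ?a ^ degree (g j) * (to_fract (coeff (g j) k) * (?y / ?a) ^ k))"
    unfolding slice_subst_def x by (simp add: poly_altdef degree_map_poly coeff_map_poly sum_distrib_left)
  also have "\<dots> = (\<Sum>k\<le>degree (g j). to_fract (coeff (g j) k) * ?y ^ k * ?a ^ (degree (g j) - k))"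
  proof (rule sum.cong)
    fix k assume "k \<in> {..degree (g j)}"
    then have "?a ^ degree (g j) = ?a ^ (degree (g j) - k) * ?a ^ k" by (simp flip: power_add)
    then show "?a ^ degree (g j) * (to_fract (coeff (g j) k) * (?y / ?a) ^ k) =
        to_fract (coeff (g j) k) * ?y ^ k * ?a ^ (degree (g j) - k)"
      using a by (simp add: power_divide)
  qed simp
  also have "\<dots> = to_fract (B j)" by (simp add: B_def to_fract_power)
  finally show ?thesis by simp
qed

lemma meval_B:
  assumes "v \<in> D"
  shows "meval (B j) v = meval A0 v ^ degree (g j) * proj v j"
proof -
  let ?a = "meval A0 v" and ?y = "- 1 / of_nat d * meval A1 v"
  have a: "?a \<noteq> 0" using assms by (simp add: D_D)
  have x: "slice v = ?y / ?a" by (simp add: slice_def)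
  have "poly (orbit_poly j v) (slice v) = (\<Sum>k\<le>degree (g j). coeff (orbit_poly j v) k * slice v ^ k)"
    using arg_cong[OF poly_as_sum_of_monoms'[of "orbit_poly j v" "degree (g j)"],
        of "\<lambda>p. poly p (slice v)"]
    by (simp add: orbit_poly_def map_poly_degree_leq poly_sum poly_monom)
  then have "?a ^ degree (g j) * proj v j =
      (\<Sum>k\<le>degree (g j). ?a ^ degree (g j) * (meval (coeff (g j) k) v * (?y / ?a) ^ k))"
    unfolding proj_def poly_orbit_poly x
    by (simp add: orbit_poly_def coeff_map_poly sum_distrib_left)
  also have "\<dots> = (\<Sum>k\<le>degree (g j). meval (coeff (g j) k) v * ?y ^ k * ?a ^ (degree (g j) - k))"
  proof (rule sum.cong)
    fix k assume "k \<in> {..degree (g j)}"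
    then have "?a ^ degree (g j) = ?a ^ (degree (g j) - k) * ?a ^ k" by (simp flip: power_add)
    then show "?a ^ degree (g j) * (meval (coeff (g j) k) v * (?y / ?a) ^ k) =
        meval (coeff (g j) k) v * ?y ^ k * ?a ^ (degree (g j) - k)"
      using a by (simp only: power_divide) simp
  qed simp
  also have "\<dots> = meval (B j) v" by (simp add: B_def)
  finally show ?thesis by simp
qed

lemma a_invariant: "rc A0 \<in> Ga_invariants V I g"
  by (simp add: Ga_invariants_iff A0_move)

lemma b_invariant: "rc (B j) \<in> Ga_invariants V I g"
  unfolding Ga_invariants_iff_D
proof (intro allI ballI)
  fix t v assume v: "v \<in> D"
  show "meval (B j) (mv t v) = meval (B j) v"
    using meval_B[OF v] meval_B[OF move_D[OF v]] v by (simp add: proj_move A0_move D_D)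
qed

section \<open>The localized ring of invariants and the invariantization\<close>

definition invariant_functions :: "(('n \<Rightarrow> 'k) \<Rightarrow> 'k) set" where
  "invariant_functions = {f. regular f \<and> (\<forall>t. \<forall>v\<in>D. f (mv t v) = f v)}"

abbreviation "\<iota> \<equiv> (\<lambda>f. loc_frac KX (rc A0) f 0)"
abbreviation "inva \<equiv> loc_frac KX (rc A0) \<one>\<^bsub>KX\<^esub> 1"
abbreviation "Kim \<equiv> range (\<lambda>c. \<iota> (rc (mconst c)))"
abbreviation "KXGa \<equiv> subalgebra_generated KXa (\<iota> ` Ga_invariants V I g) {inva}"
abbreviation "Kab \<equiv> subalgebra_generated KXa Kim ({inva, \<iota> (rc A0)} \<union> range (\<lambda>j. \<iota> (rc (B j))))"

lemma iota_eq: "\<iota> (rc F) = fraction_of (meval F)"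
  by (simp add: frac_eq)

lemma inva_eq: "inva = fraction_of (\<lambda>v. 1 / meval A0 v)"
  by (simp add: coord_ring_simps frac_eq)

lemma KXGa_subset: "KXGa \<subseteq> fraction_of ` invariant_functions"
proof
  fix u assume "u \<in> KXGa"
  then show "u \<in> fraction_of ` invariant_functions" unfolding subalgebra_generated_def
  proof induction
    case one
    show ?case unfolding localization_one
      by (rule imageI) (simp add: invariant_functions_def regular_const)
  next
    case (incl u)
    then show ?case
    proof
      assume "u \<in> \<iota> ` Ga_invariants V I g"
      then obtain s where s: "s \<in> Ga_invariants V I g" "u = \<iota> s" by blast
      then obtain F where F: "s = rc F" by (auto simp: Ga_invariants_def carrier_coord_ring)
      have "meval F \<in> invariant_functions"
        using s(1) by (simp add: F Ga_invariants_iff_D invariant_functions_def regular_meval)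
      then show ?thesis unfolding s(2) F iota_eq by (rule imageI)
    next
      assume "u \<in> {inva}"
      moreover have "(\<lambda>v. 1 / meval A0 v) \<in> invariant_functions"
        using regular_inverse_A[of 1] by (simp add: invariant_functions_def A0_move D_D)
      ultimately show ?thesis by (simp add: inva_eq del: One_nat_def)
    qed
  next
    case (a_inv u)
    then obtain f where f: "f \<in> invariant_functions" "u = fraction_of f" by blast
    then have "\<ominus>\<^bsub>KXa\<^esub> u = fraction_of (\<lambda>v. - f v)"
      by (simp add: invariant_functions_def localization_uminus)
    moreover have "(\<lambda>v. - f v) \<in> invariant_functions"
      using f by (simp add: invariant_functions_def regular_uminus)
    ultimately show ?case by simp
  next
    case (eng_add u w)
    then obtain f f' where f: "f \<in> invariant_functions" "u = fraction_of f"
      "f' \<in> invariant_functions" "w = fraction_of f'" by blast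
    then have "u \<oplus>\<^bsub>KXa\<^esub> w = fraction_of (\<lambda>v. f v + f' v)"
      by (simp add: invariant_functions_def localization_add)
    moreover have "(\<lambda>v. f v + f' v) \<in> invariant_functions"
      using f by (simp add: invariant_functions_def regular_add)
    ultimately show ?case by simp
  next
    case (eng_mult u w)
    then obtain f f' where f: "f \<in> invariant_functions" "u = fraction_of f"
      "f' \<in> invariant_functions" "w = fraction_of f'" by blast
    then have "u \<otimes>\<^bsub>KXa\<^esub> w = fraction_of (\<lambda>v. f v * f' v)"
      by (simp add: invariant_functions_def localization_mult)
    moreover have "(\<lambda>v. f v * f' v) \<in> invariant_functions"
      using f by (simp add: invariant_functions_def regular_mult)
    ultimately show ?case by simp
  qed
qed

lemma Kab_subset: "Kab \<subseteq> KXGa"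
proof
  have iota_inv: "\<iota> (rc F) \<in> KXGa" if "rc F \<in> Ga_invariants V I g" for F
    unfolding subalgebra_generated_def by (rule generate_ring.incl) (use that in blast)
  have inva: "inva \<in> KXGa"
    unfolding subalgebra_generated_def by (rule generate_ring.incl) blast
  have const: "rc (mconst c) \<in> Ga_invariants V I g" for c
    by (simp add: Ga_invariants_iff)
  fix u assume "u \<in> Kab"
  then show "u \<in> KXGa" unfolding subalgebra_generated_def[of KXa Kim]
  proof induction
    case (incl u)
    then show ?case using iota_inv[OF const] iota_inv[OF a_invariant] iota_inv[OF b_invariant] inva
      by (elim UnE insertE imageE) simp_all
  qed (simp_all add: subalgebra_generated_def generate_ring.intros)
qed

lemma Kab_intros:
  "\<iota> (rc (mconst c)) \<in> Kab" "inva \<in> Kab" "\<iota> (rc (B j)) \<in> Kab"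
  "u \<in> Kab \<Longrightarrow> w \<in> Kab \<Longrightarrow> u \<oplus>\<^bsub>KXa\<^esub> w \<in> Kab"
  "u \<in> Kab \<Longrightarrow> w \<in> Kab \<Longrightarrow> u \<otimes>\<^bsub>KXa\<^esub> w \<in> Kab"
  unfolding subalgebra_generated_def
  by (blast intro: generate_ring.incl generate_ring.eng_add generate_ring.eng_mult)+

lemma Kab_inverse_pow: "regular f \<Longrightarrow> fraction_of f \<in> Kab \<Longrightarrow> fraction_of (\<lambda>v. f v / meval A0 v ^ n) \<in> Kab"
proof -
  assume f: "regular f" "fraction_of f \<in> Kab"
  have inv: "fraction_of (\<lambda>v. 1 / meval A0 v) \<in> Kab" using Kab_intros(2) unfolding inva_eq .
  show "fraction_of (\<lambda>v. f v / meval A0 v ^ n) \<in> Kab"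
  proof (induction n)
    case 0
    then show ?case using f(2) by simp
  next
    case (Suc n)
    have reg: "regular (\<lambda>v. f v / meval A0 v ^ n)"
      using regular_mult[OF f(1) regular_inverse_A[of n]] by simp
    have "fraction_of (\<lambda>v. f v / meval A0 v ^ n) \<otimes>\<^bsub>KXa\<^esub> fraction_of (\<lambda>v. 1 / meval A0 v) \<in> Kab"
      by (rule Kab_intros(5)[OF Suc inv])
    then show ?case
      using localization_mult[OF reg regular_inverse_A[of 1]] by (simp add: mult.commute)
  qed
qed

text \<open>
  The coordinates of \<open>proj\<close> are \<open>b\<^sub>j / a ^ d\<^sub>j\<close>, and pulling back is compatible with sums and products.
\<close>

lemma proj_pullback:
  "regular (\<lambda>v. meval F (proj v)) \<and> fraction_of (\<lambda>v. meval F (proj v)) \<in> Kab"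
  using mpolys_in_UNIV[of F]
proof induction
  case (const c)
  show ?case using Kab_intros(1)[of c] by (simp add: regular_const frac_eq)
next
  case (var j)
  have eq: "meval (B j) v / meval A0 v ^ degree (g j) = meval (mvar j) (proj v)" if "v \<in> D" for v
    using that by (simp add: meval_B D_D)
  have "regular (\<lambda>v. meval (mvar j) (proj v))"
    by (rule regular_cong[OF regular_frac eq])
  moreover have "fraction_of (\<lambda>v. meval (B j) v / meval A0 v ^ degree (g j)) =
      fraction_of (\<lambda>v. meval (mvar j) (proj v))"
    by (rule fraction_of_cong) (rule eq)
  moreover have "fraction_of (meval (B j)) \<in> Kab" using Kab_intros(3)[of j] by (simp only: iota_eq)
  then have "fraction_of (\<lambda>v. meval (B j) v / meval A0 v ^ degree (g j)) \<in> Kab"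
    by (rule Kab_inverse_pow[OF regular_meval])
  ultimately show ?case by simp
next
  case (add F G)
  note reg = conjunct1[OF add.IH(1)] conjunct1[OF add.IH(2)]
  show ?case
    using regular_add[OF reg] Kab_intros(4)[OF conjunct2[OF add.IH(1)] conjunct2[OF add.IH(2)]]
    unfolding localization_add[OF reg] by simp
next
  case (mult F G)
  note reg = conjunct1[OF mult.IH(1)] conjunct1[OF mult.IH(2)]
  show ?case
    using regular_mult[OF reg] Kab_intros(5)[OF conjunct2[OF mult.IH(1)] conjunct2[OF mult.IH(2)]]
    unfolding localization_mult[OF reg] by simp
qed

lemma A0_proj: "v \<in> D \<Longrightarrow> meval A0 (proj v) = meval A0 v"
  by (simp add: proj_def A0_move D_D)

lemma regular_proj:
  assumes "regular f"
  shows "regular (\<lambda>v. f (proj v))" "fraction_of (\<lambda>v. f (proj v)) \<in> Kab"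
proof -
  from assms obtain F m where F: "\<forall>v\<in>D. f v = meval F v / meval A0 v ^ m"
    unfolding regular_def by blast
  have eq: "meval F (proj v) / meval A0 v ^ m = f (proj v)" if "v \<in> D" for v
    using F proj_D[OF that] A0_proj[OF that] by simp
  have "regular (\<lambda>v. meval F (proj v) / meval A0 v ^ m)"
    using regular_mult[OF conjunct1[OF proj_pullback[of F]] regular_inverse_A[of m]] by simp
  then show "regular (\<lambda>v. f (proj v))" by (rule regular_cong) (rule eq)
  have "fraction_of (\<lambda>v. meval F (proj v) / meval A0 v ^ m) = fraction_of (\<lambda>v. f (proj v))"
    by (rule fraction_of_cong) (rule eq)
  then show "fraction_of (\<lambda>v. f (proj v)) \<in> Kab"
    using Kab_inverse_pow[OF conjunct1[OF proj_pullback] conjunct2[OF proj_pullback], of F m]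
    by simp
qed

lemma invariant_functions_proj:
  assumes "f \<in> invariant_functions"
  shows "fraction_of (\<lambda>v. f (proj v)) = fraction_of f"
  by (rule fraction_of_cong) (use assms in \<open>simp add: invariant_functions_def proj_def\<close>)

text \<open>
  The chain \<open>Kab \<subseteq> KXGa \<subseteq> invariant functions \<subseteq> Kab\<close> closes because an invariant function is its own
  pullback along \<open>proj\<close>.
\<close>

lemma Kab_eq: "Kab = fraction_of ` invariant_functions"
  and KXGa_eq: "KXGa = fraction_of ` invariant_functions"
proof -
  have "fraction_of f \<in> Kab" if "f \<in> invariant_functions" for f
    using regular_proj(2)[of f] invariant_functions_proj[OF that] that
    by (simp add: invariant_functions_def)
  then have "fraction_of ` invariant_functions \<subseteq> Kab" by blast
  then show "Kab = fraction_of ` invariant_functions" "KXGa = fraction_of ` invariant_functions"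
    using Kab_subset KXGa_subset by blast+
qed

text \<open>
  The choice of \<open>f\<close> is harmless: two regular functions representing the same fraction agree on \<open>D\<close>, and
  \<open>proj\<close> maps \<open>D\<close> to itself.
\<close>

definition invariantization ::
  "(('n, 'k) mpoly set \<times> nat) set \<Rightarrow> (('n, 'k) mpoly set \<times> nat) set" where
  "invariantization u =
    fraction_of (\<lambda>v. (SOME f. regular f \<and> u = fraction_of f) (proj v))"

lemma invariantization_eq:
  assumes "regular f"
  shows "invariantization (fraction_of f) = fraction_of (\<lambda>v. f (proj v))"
proof -
  let ?f = "SOME f'. regular f' \<and> fraction_of f = fraction_of f'"
  have "regular ?f \<and> fraction_of f = fraction_of ?f"
    by (rule someI[of _ f]) (simp add: assms)
  then have "\<forall>v\<in>D. f v = ?f v" using fraction_of_eq_iff[OF assms] by blast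
  then show ?thesis unfolding invariantization_def
    by (intro fraction_of_cong) (simp add: proj_D)
qed

lemma invariantization_closed: "u \<in> carrier KXa \<Longrightarrow> invariantization u \<in> KXGa"
  unfolding KXGa_eq carrier_localization
  by (auto simp: invariantization_eq invariant_functions_def regular_proj(1) proj_move intro!: imageI)

lemma invariantization_fixes:
  assumes "u \<in> KXGa"
  shows "invariantization u = u"
proof -
  obtain f where f: "f \<in> invariant_functions" "u = fraction_of f" using assms unfolding KXGa_eq by blast
  then show ?thesis
    using invariantization_eq[of f] invariant_functions_proj[OF f(1)] by (simp add: invariant_functions_def)
qed

lemma invariantization_add:
  assumes "u \<in> carrier KXa" "w \<in> carrier KXa"
  shows "invariantization (u \<oplus>\<^bsub>KXa\<^esub> w) = invariantization u \<oplus>\<^bsub>KXa\<^esub> invariantization w"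
  using assms unfolding carrier_localization
  by (auto simp: localization_add invariantization_eq regular_add regular_proj(1))

lemma invariantization_mult:
  assumes "u \<in> carrier KXa" "w \<in> carrier KXa"
  shows "invariantization (u \<otimes>\<^bsub>KXa\<^esub> w) = invariantization u \<otimes>\<^bsub>KXa\<^esub> invariantization w"
  using assms unfolding carrier_localization
  by (auto simp: localization_mult invariantization_eq regular_mult regular_proj(1))

lemma invariantization_var:
  "invariantization (\<iota> (rc (mvar j))) = inva [^]\<^bsub>KXa\<^esub> degree (g j) \<otimes>\<^bsub>KXa\<^esub> \<iota> (rc (B j))"
proof -
  let ?n = "degree (g j)"
  have reg: "regular (\<lambda>v. 1 / meval A0 v)" using regular_inverse_A[of 1] by simp
  have "inva [^]\<^bsub>KXa\<^esub> ?n \<otimes>\<^bsub>KXa\<^esub> \<iota> (rc (B j)) =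
      fraction_of (\<lambda>v. (1 / meval A0 v) ^ ?n * meval (B j) v)"
    unfolding inva_eq iota_eq by (simp only: localization_pow[OF reg] localization_mult regular_meval)
  also have "\<dots> = fraction_of (\<lambda>v. meval (mvar j) (proj v))"
    by (rule fraction_of_cong) (simp add: meval_B D_D power_one_over)
  also have "\<dots> = invariantization (\<iota> (rc (mvar j)))"
    unfolding iota_eq by (rule invariantization_eq[OF regular_meval, symmetric])
  finally show ?thesis by simp
qed

lemma KXGa_carrier: "KXGa \<subseteq> carrier KXa"
  unfolding KXGa_eq carrier_localization by (auto simp: invariant_functions_def)

lemma invariantization_algebra_hom:
  assumes "S \<subseteq> KXGa"
  shows "algebra_hom S KXa (KXa\<lparr>carrier := KXGa\<rparr>) invariantization"
  unfolding algebra_hom_def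
proof (intro conjI ballI)
  show "invariantization \<in> ring_hom KXa (KXa\<lparr>carrier := KXGa\<rparr>)"
  proof (rule ring_hom_memI)
    have "\<one>\<^bsub>KXa\<^esub> \<in> KXGa" by (simp add: subalgebra_generated_def generate_ring.one)
    then show "invariantization \<one>\<^bsub>KXa\<^esub> = \<one>\<^bsub>KXa\<lparr>carrier := KXGa\<rparr>\<^esub>"
      by (simp add: invariantization_fixes)
  next
    fix u assume "u \<in> carrier KXa"
    then show "invariantization u \<in> carrier (KXa\<lparr>carrier := KXGa\<rparr>)"
      using invariantization_closed by (simp del: One_nat_def)
  qed (simp_all add: invariantization_add invariantization_mult)
next
  fix c u assume "c \<in> S" "u \<in> carrier KXa"
  moreover have "c \<in> KXGa" "c \<in> carrier KXa" using \<open>c \<in> S\<close> assms KXGa_carrier by auto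
  ultimately show "invariantization (c \<otimes>\<^bsub>KXa\<^esub> u) = c \<otimes>\<^bsub>KXa\<lparr>carrier := KXGa\<rparr>\<^esub> invariantization u"
    by (simp add: invariantization_mult invariantization_fixes)
qed

lemma invariantization_map_invariantization: "invariantization_map KXa KXGa invariantization"
  unfolding invariantization_map_def
proof (intro conjI ballI)
  show "invariantization \<in> carrier KXa \<rightarrow> KXGa" by (rule Pi_I) (rule invariantization_closed)
next
  fix c u assume "c \<in> KXGa" "u \<in> carrier KXa"
  then show "invariantization (c \<otimes>\<^bsub>KXa\<^esub> u) = c \<otimes>\<^bsub>KXa\<^esub> invariantization u"
    using KXGa_carrier by (simp add: invariantization_mult invariantization_fixes subset_iff)
qed (simp_all add: invariantization_add invariantization_fixes)

end

theorem mainTheorem12: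
  fixes I :: "('n::{finite,linorder}, 'k::alg_closed_field) mpoly set"
    and V :: "('n \<Rightarrow> 'k) set"
    and g :: "'n \<Rightarrow> ('n, 'k) mpoly poly"
    and i :: 'n
  assumes prime: "primeideal I mpoly_ring"
    and variety: "V = zero_locus I"
    and action: "Ga_action_on V g"
    and coeffs: "\<And>j k. coeff (g j) k \<noteq> 0 \<Longrightarrow> coeff (g j) k \<notin> I"
    and i: "\<not> CHAR('k) dvd degree (g i)"
  shows
    "\<exists>B :: 'n \<Rightarrow> ('n, 'k) mpoly.
      (\<forall>j. to_fract (B j) = to_fract (top_coeff (g i) 0) ^ degree (g j) * slice_subst g i j) \<and>
      (let KX = coord_ring I;
           KXG = Ga_invariants V I g;
           a = residue_class I (top_coeff (g i) 0);
           b = (\<lambda>j. residue_class I (B j));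
           KXa = localization KX a;
           \<iota> = (\<lambda>f. loc_frac KX a f 0);
           inva = loc_frac KX a \<one>\<^bsub>KX\<^esub> 1;
           K = range (\<lambda>c. \<iota> (residue_class I (mconst c)));
           KXGa = subalgebra_generated KXa (\<iota> ` KXG) {inva}
       in a \<noteq> \<zero>\<^bsub>KX\<^esub> \<and> a \<in> KXG \<and> (\<forall>j. b j \<in> KXG) \<and>
          KXGa = subalgebra_generated KXa K ({inva, \<iota> a} \<union> range (\<lambda>j. \<iota> (b j))) \<and>
          (\<exists>\<phi>. algebra_hom K KXa (KXa\<lparr>carrier := KXGa\<rparr>) \<phi> \<and>
               \<phi> inva = inva \<and>
               (\<forall>j. \<phi> (\<iota> (residue_class I (mvar j))) =
                    inva [^]\<^bsub>KXa\<^esub> degree (g j) \<otimes>\<^bsub>KXa\<^esub> \<iota> (b j)) \<and>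
               invariantization_map KXa KXGa \<phi> \<and>
               algebra_hom KXGa KXa (KXa\<lparr>carrier := KXGa\<rparr>) \<phi>))"
proof -
  interpret affine_variety I V
    by (rule affine_variety.intro[OF prime variety])
  have "g i \<noteq> 0" using i by auto
  then interpret Ga_slice I V g i
    using action coeffs i
    by (intro Ga_slice.intro Ga_slice_axioms.intro affine_variety_axioms) auto
  have a: "rc A0 \<noteq> \<zero>\<^bsub>KX\<^esub>"
    using A_notin unfolding coord_ring_simps residue_class_eq_iff by (auto simp: mem_ideal_iff)
  have K: "Kim \<subseteq> KXGa" using Kab_intros(1) Kab_eq KXGa_eq by blast
  have inva: "inva \<in> KXGa" using Kab_intros(2) Kab_eq KXGa_eq by blast
  have eq: "KXGa = Kab" by (simp only: KXGa_eq Kab_eq)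
  show ?thesis
    unfolding Let_def
    by (intro exI[of _ B] exI[of _ invariantization] conjI allI to_fract_B a a_invariant b_invariant
        eq invariantization_algebra_hom[OF K] invariantization_fixes[OF inva] invariantization_var
        invariantization_map_invariantization invariantization_algebra_hom[OF subset_refl])
qed

end
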